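(* Let $k$ be an algebraically closed field with $\mathrm{char}(k) > 0$, let $r \geq 3$ and $1 \leq d \leq r-1$. Then $\mathrm{ESP}_{2,d}(E_r) \setminus \mathrm{ESP}_{2,d-1}(E_r)$ has wild representation type, where $\mathrm{ESP}_{2,0}(E_r) := \emptyset$.
   Context: $p = \mathrm{char}(k)$; $E_r$ is a $p$-elementary abelian group of rank $r$ with generators $g_1,\dots,g_r$, and $x_i := g_i - 1 \in kE_r$, so $kE_r \cong k[X_1,\dots,X_r]/(X_1^p,\dots,X_r^p)$ via $X_i \mapsto x_i$. $\mathrm{mod}\,kE_r$ is the category of finite-dimensional $kE_r$-modules. Let $\mathbb{V} = \langle x_1,\dots,x_r\rangle_k \subseteq \mathrm{rad}(kE_r)$ and let $\mathrm{Gr}_{d,\mathbb{V}}$ be the set of $d$-dimensional subspaces of $\mathbb{V}$. For $U \in \mathrm{Gr}_{d,\mathbb{V}}$ and $M \in \mathrm{mod}\,kE_r$ put $\mathrm{Soc}_U(M) = \{m \in M \mid u\cdot m = 0 \text{ for all } u \in U\}$. $M$ has the equal $d$-Soc property if $\mathrm{Soc}_U(M)$ is independent of the choice of $U \in \mathrm{Gr}_{d,\mathbb{V}}$. For $1 \le d < r$, $\mathrm{ESP}_{2,d}(E_r)$ is the full subcategory of $\mathrm{mod}\,kE_r$ of modules of Loewy length $\leq 2$ with the equal $d$-Soc property. Wild is meant in the usual sense: a full subcategory $\mathcal{D}$ of $\mathrm{mod}\,A$ is wild (of wild representation type) if there is an exact $k$-linear functor from finite-dimensional $k\langle X,Y\rangle$-modules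 to $\mathrm{mod}\,A$ which preserves indecomposability, reflects isomorphism classes, and takes nonzero modules to objects of $\mathcal{D}$. *)

theory Defs
  imports
    "HOL-Library.Poly_Mapping"
    "HOL-Computational_Algebra.Computational_Algebra"
    "Jordan_Normal_Form.Matrix"
begin

section \<open>Monoid algebras\<close>

text \<open>
  For a monoid \<open>'m\<close>, written additively, the type \<open>'m \<Rightarrow>\<^sub>0 'k\<close> with the convolution product of
  the library is the monoid algebra of \<open>'m\<close> over \<open>'k\<close>; the monoid element \<open>s\<close> corresponds to
  \<open>Poly_Mapping.single s 1\<close>. If \<open>'m\<close> is an abelian group, this is the group algebra; if \<open>'m\<close> is the
  free monoid on two letters, this is the free algebra \<open>k\<langle>X,Y\<rangle>\<close>.
\<close>

definition malg_scale :: "'k::field \<Rightarrow> ('m::monoid_add \<Rightarrow>\<^sub>0 'k) \<Rightarrow> ('m \<Rightarrow>\<^sub>0 'k)" where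
  "malg_scale c a = Poly_Mapping.single 0 c * a"

interpretation malg: vector_space "malg_scale :: 'k::field \<Rightarrow> ('m::monoid_add \<Rightarrow>\<^sub>0 'k) \<Rightarrow> ('m \<Rightarrow>\<^sub>0 'k)"
  by unfold_locales
    (simp_all add: malg_scale_def algebra_simps single_add mult_single flip: mult.assoc)

datatype 'a free_monoid = Word "'a list"

instantiation free_monoid :: (type) monoid_add
begin

definition zero_free_monoid :: "'a free_monoid" where
  "0 = Word []"

fun plus_free_monoid :: "'a free_monoid \<Rightarrow> 'a free_monoid \<Rightarrow> 'a free_monoid" where
  "Word u + Word v = Word (u @ v)"

instance
proof
  fix a b c :: "'a free_monoid"
  show "a + b + c = a + (b + c)" by (cases a; cases b; cases c) simp
  show "0 + a = a" "a + 0 = a" by (cases a; simp add: zero_free_monoid_def)+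
qed

end

section \<open>Finite-dimensional modules\<close>

text \<open>
  A finite-dimensional left module over a monoid algebra \<open>A\<close> is given, after the choice of a
  basis, by its dimension \<open>n\<close> and a homomorphism of unital \<open>k\<close>-algebras from \<open>A\<close> to the
  \<open>n \<times> n\<close> matrices acting on column vectors. A homomorphism from \<open>M\<close> to \<open>N\<close> is a
  (\<open>dim N\<close> \<open>\<times>\<close> \<open>dim M\<close>) matrix commuting with the actions. The resulting category
  is equivalent to the category of all finite-dimensional modules, and contains the zero module
  as the module of dimension \<open>0\<close>.
\<close>

record (overloaded) ('m, 'k) fdmod =
  mdim :: nat
  act :: "('m \<Rightarrow>\<^sub>0 'k::zero) \<Rightarrow> 'k mat"

definition fdmods :: "('m::monoid_add, 'k::field) fdmod set" where
  "fdmods = {M.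
     (\<forall>a. act M a \<in> carrier_mat (mdim M) (mdim M)) \<and>
     act M 1 = 1\<^sub>m (mdim M) \<and>
     (\<forall>a b. act M (a * b) = act M a * act M b) \<and>
     (\<forall>a b. act M (a + b) = act M a + act M b) \<and>
     (\<forall>c a. act M (malg_scale c a) = c \<cdot>\<^sub>m act M a)}"

abbreviation vecs :: "('m::monoid_add, 'k::field) fdmod \<Rightarrow> 'k vec set" where
  "vecs M \<equiv> carrier_vec (mdim M)"

definition fdhom :: "('m::monoid_add, 'k::field) fdmod \<Rightarrow> ('m, 'k) fdmod \<Rightarrow> 'k mat set" where
  "fdhom M N = {f \<in> carrier_mat (mdim N) (mdim M). \<forall>a. f * act M a = act N a * f}"

definition isomorphic :: "('m::monoid_add, 'k::field) fdmod \<Rightarrow> ('m, 'k) fdmod \<Rightarrow> bool" where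
  "isomorphic M N \<longleftrightarrow>
     (\<exists>f \<in> fdhom M N. \<exists>g \<in> fdhom N M. g * f = 1\<^sub>m (mdim M) \<and> f * g = 1\<^sub>m (mdim N))"

definition short_exact ::
  "('m::monoid_add, 'k::field) fdmod \<Rightarrow> ('m, 'k) fdmod \<Rightarrow> ('m, 'k) fdmod \<Rightarrow> 'k mat \<Rightarrow> 'k mat \<Rightarrow> bool"
where
  "short_exact L M N f g \<longleftrightarrow>
     f \<in> fdhom L M \<and> g \<in> fdhom M N \<and>
     inj_on (\<lambda>v. f *\<^sub>v v) (vecs L) \<and>
     (\<lambda>v. f *\<^sub>v v) ` vecs L = {v \<in> vecs M. g *\<^sub>v v = 0\<^sub>v (mdim N)} \<and>
     (\<lambda>v. g *\<^sub>v v) ` vecs M = vecs N"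

definition fdsubmodule :: "('m::monoid_add, 'k::field) fdmod \<Rightarrow> 'k vec set \<Rightarrow> bool" where
  "fdsubmodule M W \<longleftrightarrow>
     W \<subseteq> vecs M \<and> 0\<^sub>v (mdim M) \<in> W \<and>
     (\<forall>v \<in> W. \<forall>w \<in> W. v + w \<in> W) \<and>
     (\<forall>a. \<forall>w \<in> W. act M a *\<^sub>v w \<in> W)"

definition indecomposable :: "('m::monoid_add, 'k::field) fdmod \<Rightarrow> bool" where
  "indecomposable M \<longleftrightarrow>
     mdim M \<noteq> 0 \<and>
     (\<forall>W W'. fdsubmodule M W \<and> fdsubmodule M W' \<and>
        W \<inter> W' = {0\<^sub>v (mdim M)} \<and> {w + w' | w w'. w \<in> W \<and> w' \<in> W'} = vecs M \<longrightarrow>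
        W = {0\<^sub>v (mdim M)} \<or> W' = {0\<^sub>v (mdim M)})"

definition maximal_submodule ::
  "('m::monoid_add, 'k::field) fdmod \<Rightarrow> 'k vec set \<Rightarrow> 'k vec set \<Rightarrow> bool"
where
  "maximal_submodule M W N \<longleftrightarrow>
     fdsubmodule M N \<and> N \<subset> W \<and>
     (\<forall>L. fdsubmodule M L \<and> N \<subseteq> L \<and> L \<subseteq> W \<longrightarrow> L = N \<or> L = W)"

text \<open>The radical of a submodule \<open>W\<close> of \<open>M\<close>; if \<open>W = 0\<close>, the intersection is just \<open>W\<close>.\<close>

definition radical :: "('m::monoid_add, 'k::field) fdmod \<Rightarrow> 'k vec set \<Rightarrow> 'k vec set" where
  "radical M W = W \<inter> \<Inter> {N. maximal_submodule M W N}"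

definition loewy_length :: "('m::monoid_add, 'k::field) fdmod \<Rightarrow> nat" where
  "loewy_length M = (LEAST n. (radical M ^^ n) (vecs M) = {0\<^sub>v (mdim M)})"

section \<open>Functors and wildness\<close>

text \<open>
  A functor consists of a map on objects and, for each pair of objects \<open>M\<close>, \<open>N\<close>, a map from
  \<open>fdhom M N\<close>; only the values on actual modules and homomorphisms matter. Composition of
  homomorphisms is the matrix product.
\<close>

definition exact_linear_functor ::
  "(('m::monoid_add, 'k::field) fdmod \<Rightarrow> ('n::monoid_add, 'k) fdmod) \<Rightarrow>
   (('m, 'k) fdmod \<Rightarrow> ('m, 'k) fdmod \<Rightarrow> 'k mat \<Rightarrow> 'k mat) \<Rightarrow> bool"
where
  "exact_linear_functor F Fh \<longleftrightarrow>
     (\<forall>M \<in> fdmods. F M \<in> fdmods) \<and>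
     (\<forall>M \<in> fdmods. \<forall>N \<in> fdmods. \<forall>f \<in> fdhom M N. Fh M N f \<in> fdhom (F M) (F N)) \<and>
     (\<forall>M \<in> fdmods. Fh M M (1\<^sub>m (mdim M)) = 1\<^sub>m (mdim (F M))) \<and>
     (\<forall>L \<in> fdmods. \<forall>M \<in> fdmods. \<forall>N \<in> fdmods. \<forall>f \<in> fdhom L M. \<forall>g \<in> fdhom M N.
        Fh L N (g * f) = Fh M N g * Fh L M f) \<and>
     (\<forall>M \<in> fdmods. \<forall>N \<in> fdmods. \<forall>f \<in> fdhom M N. \<forall>g \<in> fdhom M N.
        Fh M N (f + g) = Fh M N f + Fh M N g) \<and>
     (\<forall>M \<in> fdmods. \<forall>N \<in> fdmods. \<forall>c. \<forall>f \<in> fdhom M N. Fh M N (c \<cdot>\<^sub>m f) = c \<cdot>\<^sub>m Fh M N f) \<and>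
     (\<forall>L \<in> fdmods. \<forall>M \<in> fdmods. \<forall>N \<in> fdmods. \<forall>f g. short_exact L M N f g \<longrightarrow>
        short_exact (F L) (F M) (F N) (Fh L M f) (Fh M N g))"

text \<open>
  A full subcategory is given by its set of objects. The type \<open>bool free_monoid \<Rightarrow>\<^sub>0 'k\<close> is the free
  algebra on two generators.
\<close>

definition wild :: "('m::monoid_add, 'k::field) fdmod set \<Rightarrow> bool" where
  "wild D \<longleftrightarrow>
     (\<exists>(F :: (bool free_monoid, 'k) fdmod \<Rightarrow> ('m, 'k) fdmod) Fh.
        exact_linear_functor F Fh \<and>
        (\<forall>M \<in> fdmods. indecomposable M \<longrightarrow> indecomposable (F M)) \<and>
        (\<forall>M \<in> fdmods. \<forall>N \<in> fdmods. isomorphic (F M) (F N) \<longrightarrow> isomorphic M N) \<and>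
        (\<forall>M \<in> fdmods. mdim M \<noteq> 0 \<longrightarrow> F M \<in> D))"

section \<open>Elementary abelian groups and the equal socle property\<close>

text \<open>
  The type \<open>'e\<close>, written additively, is a \<open>p\<close>-elementary abelian group of rank \<open>r\<close> with
  generators \<open>g 1, \<dots>, g r\<close>; \<open>gen g i\<close> is \<open>x\<^sub>i = g\<^sub>i - 1\<close> in the group algebra.
\<close>

definition elementary_abelian :: "nat \<Rightarrow> nat \<Rightarrow> (nat \<Rightarrow> 'e::ab_group_add) \<Rightarrow> bool" where
  "elementary_abelian p r g \<longleftrightarrow>
     (\<forall>a :: 'e. (\<Sum>i<p. a) = 0) \<and> card (UNIV :: 'e set) = p ^ r \<and> group_closure (g ` {1..r}) = UNIV"

definition gen :: "(nat \<Rightarrow> 'e::ab_group_add) \<Rightarrow> nat \<Rightarrow> ('e \<Rightarrow>\<^sub>0 'k::field)" where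
  "gen g i = Poly_Mapping.single (g i) 1 - 1"

definition VV :: "(nat \<Rightarrow> 'e::ab_group_add) \<Rightarrow> nat \<Rightarrow> ('e \<Rightarrow>\<^sub>0 'k::field) set" where
  "VV g r = malg.span (gen g ` {1..r})"

definition Gr :: "nat \<Rightarrow> ('e::ab_group_add \<Rightarrow>\<^sub>0 'k::field) set \<Rightarrow> ('e \<Rightarrow>\<^sub>0 'k) set set" where
  "Gr d V = {U. malg.subspace U \<and> U \<subseteq> V \<and> malg.dim U = d}"

definition Soc :: "('e::ab_group_add \<Rightarrow>\<^sub>0 'k::field) set \<Rightarrow> ('e, 'k) fdmod \<Rightarrow> 'k vec set" where
  "Soc U M = {m \<in> vecs M. \<forall>u \<in> U. act M u *\<^sub>v m = 0\<^sub>v (mdim M)}"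

definition equal_Soc ::
  "(nat \<Rightarrow> 'e::ab_group_add) \<Rightarrow> nat \<Rightarrow> nat \<Rightarrow> ('e, 'k::field) fdmod \<Rightarrow> bool"
where
  "equal_Soc g r d M \<longleftrightarrow> (\<forall>U \<in> Gr d (VV g r). \<forall>U' \<in> Gr d (VV g r). Soc U M = Soc U' M)"

text \<open>The value at \<open>d = 0\<close> is a convention: \<open>equal_Soc g r 0 M\<close> itself holds for every \<open>M\<close>.\<close>

definition ESP2 :: "(nat \<Rightarrow> 'e::ab_group_add) \<Rightarrow> nat \<Rightarrow> nat \<Rightarrow> ('e, 'k::field) fdmod set" where
  "ESP2 g r d = (if d = 0 then {} else {M \<in> fdmods. loewy_length M \<le> 2 \<and> equal_Soc g r d M})"

end

theory Submission
  imports Defs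
begin

text \<open>
  A matrix of size \<open>c\<close> over \<open>k\<langle>X,Y\<rangle>\<close> for each generator \<open>x\<^sub>i\<close>, all of them concentrated in the lower left
  corner, turns a \<open>k\<langle>X,Y\<rangle>\<close>-module \<open>N\<close> into a module \<open>N\<^sup>c\<close> over the group algebra on which products of two
  generators vanish; this is an exact functor with \<open>f \<mapsto> f \<oplus> \<cdots> \<oplus> f\<close> on homomorphisms. If it is full up to the
  square-zero ideal of homomorphisms from the top to the socle, then it reflects isomorphism and
  preserves indecomposability. Put \<open>s = r - d + 1 \<ge> 2\<close>. A \<open>d\<close>-dimensional \<open>U\<close> meets the span of
  \<open>x\<^sub>1, \<dots>, x\<^sub>s\<close>, so if every nonzero combination of these acts injectively on the top, then \<open>Soc\<^sub>U\<close> does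
  not depend on \<open>U\<close>; and if \<open>x\<^sub>s\<^sub>+\<^sub>1, \<dots>, x\<^sub>r\<close> have a common kernel vector in the top, then the equal
  \<open>(d - 1)\<close>-Soc property fails. Such matrices are written down separately for \<open>s = 2\<close> and \<open>s \<ge> 3\<close>.
\<close>

section \<open>Block matrices\<close>

text \<open>Modules on which products of two generators vanish come from representations of the
  Kronecker quiver with r arrows, running from top to socle. Every linear map from top to socle
  commutes with all x_i, so fullness can only be expected modulo such maps. An element a of the
  group algebra acts as aug(a) + sum_i D_i(a) T_i, where the D_i extend additive maps from the group
  to k that are dual to the g_i; they exist because the exponent of the group is the characteristic
  of k. Two families occur because of s. For s >= 3 the generators x_1, ..., x_s can carry all the
  information; the others act as zero, so they certainly have a common kernel vector. For s = 2 the
  generators x_1, x_2 alone give only the tame Kronecker quiver with two arrows, so wildness has to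
  sit in x_3, which must nevertheless kill a vector of the top. That construction in turn does not
  serve s >= 3, where x_3 has to act injectively.\<close>

definition block :: "nat \<Rightarrow> nat \<Rightarrow> 'a mat \<Rightarrow> nat \<Rightarrow> nat \<Rightarrow> 'a mat" where
  "block m n A p q = mat m n (\<lambda>(i, j). A $$ (p * m + i, q * n + j))"

definition block_mat :: "nat \<Rightarrow> nat \<Rightarrow> nat \<Rightarrow> nat \<Rightarrow> (nat \<Rightarrow> nat \<Rightarrow> 'a mat) \<Rightarrow> 'a mat" where
  "block_mat m c n d B =
     mat (c * m) (d * n) (\<lambda>(i, j). B (i div m) (j div n) $$ (i mod m, j mod n))"

definition vblock :: "nat \<Rightarrow> 'a vec \<Rightarrow> nat \<Rightarrow> 'a vec" where
  "vblock n v p = vec n (\<lambda>i. v $ (p * n + i))"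

definition block_vec :: "nat \<Rightarrow> nat \<Rightarrow> (nat \<Rightarrow> 'a vec) \<Rightarrow> 'a vec" where
  "block_vec n c w = vec (c * n) (\<lambda>i. w (i div n) $ (i mod n))"

lemma block_index_less:
  assumes "p < c" "i < n"
  shows "p * n + i < c * (n::nat)"
proof -
  have "p * n + i < Suc p * n" using assms by simp
  also have "\<dots> \<le> c * n" using assms by (intro mult_le_mono1) auto
  finally show ?thesis .
qed

lemma block_index_cases:
  assumes "k < c * (n::nat)"
  obtains p i where "p < c" "i < n" "k = p * n + i"
proof -
  have "n > 0" using assms by (cases n) auto
  then show ?thesis
    using that[of "k div n" "k mod n"] assms by (simp add: less_mult_imp_div_less)
qed

lemma sum_blocks: "(\<Sum>k<c * n. f k) = (\<Sum>t<c. \<Sum>l<n. f (t * n + l :: nat))"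
proof -
  have "(\<Sum>k<c * n. f k) = (\<Sum>t<c. sum f {t * n..<t * n + n})"
    by (rule sum.nat_group[symmetric])
  also have "\<dots> = (\<Sum>t<c. \<Sum>l<n. f (t * n + l))"
  proof (rule sum.cong[OF refl])
    fix t
    show "sum f {t * n..<t * n + n} = (\<Sum>l<n. f (t * n + l))"
      using sum.shift_bounds_nat_ivl[of f 0 "t * n" n]
      by (simp add: atLeast0LessThan add.commute)
  qed
  finally show ?thesis .
qed

lemma block_carrier [simp]: "block m n A p q \<in> carrier_mat m n"
  by (simp add: block_def)

lemma dim_block [simp]: "dim_row (block m n A p q) = m" "dim_col (block m n A p q) = n"
  by (simp_all add: block_def)

lemma vblock_carrier [simp]: "vblock n v p \<in> carrier_vec n"
  by (simp add: vblock_def)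

lemma dim_vblock [simp]: "dim_vec (vblock n v p) = n"
  by (simp add: vblock_def)

lemma block_mat_carrier [simp]: "block_mat m c n d B \<in> carrier_mat (c * m) (d * n)"
  by (simp add: block_mat_def)

lemma block_vec_carrier [simp]: "block_vec n c w \<in> carrier_vec (c * n)"
  by (simp add: block_vec_def)

lemma block_index: "i < m \<Longrightarrow> j < n \<Longrightarrow> block m n A p q $$ (i, j) = A $$ (p * m + i, q * n + j)"
  by (simp add: block_def)

lemma vblock_index: "i < n \<Longrightarrow> vblock n v p $ i = v $ (p * n + i)"
  by (simp add: vblock_def)

lemma block_block_mat:
  assumes "p < c" "q < d" "B p q \<in> carrier_mat m n"
  shows "block m n (block_mat m c n d B) p q = B p q"
  using assms by (intro eq_matI) (auto simp: block_def block_mat_def block_index_less)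

lemma vblock_block_vec:
  assumes "p < c" "w p \<in> carrier_vec n"
  shows "vblock n (block_vec n c w) p = w p"
  using assms by (intro eq_vecI) (auto simp: vblock_def block_vec_def block_index_less)

lemma block_eqI:
  assumes "A \<in> carrier_mat (c * m) (d * n)" "A' \<in> carrier_mat (c * m) (d * n)"
    and "\<And>p q. p < c \<Longrightarrow> q < d \<Longrightarrow> block m n A p q = block m n A' p q"
  shows "A = A'"
proof (rule eq_matI)
  fix k l assume "k < dim_row A'" "l < dim_col A'"
  with assms(2) have "k < c * m" "l < d * n" by auto
  then obtain p i q j where *: "p < c" "i < m" "k = p * m + i" "q < d" "j < n" "l = q * n + j"
    by (meson block_index_cases)
  then show "A $$ (k, l) = A' $$ (k, l)"
    using arg_cong[OF assms(3)[OF *(1,4)], of "\<lambda>X. X $$ (i, j)"] by (simp add: block_index)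
qed (use assms in auto)

lemma vblock_eqI:
  assumes "v \<in> carrier_vec (c * n)" "v' \<in> carrier_vec (c * n)"
    and "\<And>p. p < c \<Longrightarrow> vblock n v p = vblock n v' p"
  shows "v = v'"
proof (rule eq_vecI)
  fix k assume "k < dim_vec v'"
  with assms(2) have "k < c * n" by auto
  then obtain p i where *: "p < c" "i < n" "k = p * n + i" by (meson block_index_cases)
  then show "v $ k = v' $ k"
    using arg_cong[OF assms(3)[OF *(1)], of "\<lambda>x. vec_index x i"] by (simp add: vblock_index)
qed (use assms in auto)

text \<open>Stated entry by entry so that the sum over \<open>t\<close> is a sum of scalars:
  matrices of all sizes share one type without a common zero, so the blocks are not summed
  directly.\<close>

lemma block_mult_index:
  fixes A :: "'a::comm_semiring_0 mat"
  assumes "A \<in> carrier_mat (c * m) (d * n)" "B \<in> carrier_mat (d * n) (e * l)"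
    and "p < c" "q < e" "i < m" "j < l"
  shows "block m l (A * B) p q $$ (i, j) = (\<Sum>t<d. (block m n A p t * block n l B t q) $$ (i, j))"
proof -
  have less: "p * m + i < c * m" "q * l + j < e * l"
    using assms by (simp_all add: block_index_less)
  have "block m l (A * B) p q $$ (i, j) = (\<Sum>k<d * n. A $$ (p * m + i, k) * B $$ (k, q * l + j))"
    using assms less by (simp add: block_index scalar_prod_def atLeast0LessThan)
  also have "\<dots> = (\<Sum>t<d. (block m n A p t * block n l B t q) $$ (i, j))"
    unfolding sum_blocks using assms less
    by (intro sum.cong refl) (simp add: block_index scalar_prod_def atLeast0LessThan)
  finally show ?thesis .
qed

lemma vblock_mult_index:
  fixes A :: "'a::comm_semiring_0 mat"
  assumes "A \<in> carrier_mat (c * m) (d * n)" "v \<in> carrier_vec (d * n)"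
    and "p < c" "i < m"
  shows "vblock m (A *\<^sub>v v) p $ i = (\<Sum>t<d. (block m n A p t *\<^sub>v vblock n v t) $ i)"
proof -
  have less: "p * m + i < c * m" using assms by (simp add: block_index_less)
  have "vblock m (A *\<^sub>v v) p $ i = (\<Sum>k<d * n. A $$ (p * m + i, k) * v $ k)"
    using assms less by (simp add: vblock_index scalar_prod_def atLeast0LessThan)
  also have "\<dots> = (\<Sum>t<d. (block m n A p t *\<^sub>v vblock n v t) $ i)"
    unfolding sum_blocks using assms less
    by (intro sum.cong refl) (simp add: block_index vblock_index scalar_prod_def atLeast0LessThan)
  finally show ?thesis .
qed

lemma block_add:
  assumes "A \<in> carrier_mat (c * m) (d * n)" "B \<in> carrier_mat (c * m) (d * n)" "p < c" "q < d"
  shows "block m n (A + B) p q = block m n A p q + block m n B p q"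
  using assms by (intro eq_matI) (auto simp: block_index block_index_less)

lemma block_smult:
  assumes "A \<in> carrier_mat (c * m) (d * n)" "p < c" "q < d"
  shows "block m n (k \<cdot>\<^sub>m A) p q = k \<cdot>\<^sub>m block m n A p q"
  using assms by (intro eq_matI) (auto simp: block_index block_index_less)

lemma block_one:
  assumes "p < c" "q < c"
  shows "block n n (1\<^sub>m (c * n)) p q = (if p = q then 1\<^sub>m n else 0\<^sub>m n n)"
proof (intro eq_matI, goal_cases)
  case (1 i j)
  then have ij: "i < n" "j < n" by (auto split: if_splits)
  have "p * n + i = q * n + j \<longleftrightarrow> p = q \<and> i = j"
  proof
    assume *: "p * n + i = q * n + j"
    from arg_cong[OF *, of "\<lambda>x. x div n"] arg_cong[OF *, of "\<lambda>x. x mod n"] ij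
    show "p = q \<and> i = j" by simp
  qed auto
  then show ?case using ij assms by (auto simp: block_index block_index_less)
qed auto

section \<open>Block diagonal matrices\<close>

text \<open>The Kronecker product of the identity matrix of size \<open>c\<close> with
  \<open>f\<close>; it serves as the homomorphism induced by \<open>f\<close> between
  \<open>c\<close>-th powers of modules.\<close>

definition bdiag :: "nat \<Rightarrow> 'a::zero mat \<Rightarrow> 'a mat" where
  "bdiag c f = block_mat (dim_row f) c (dim_col f) c
     (\<lambda>p q. if p = q then f else 0\<^sub>m (dim_row f) (dim_col f))"

lemma bdiag_carrier [simp]:
  "f \<in> carrier_mat m n \<Longrightarrow> bdiag c f \<in> carrier_mat (c * m) (c * n)"
  by (auto simp: bdiag_def)

lemma block_bdiag:
  assumes "f \<in> carrier_mat m n" "p < c" "q < c"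
  shows "block m n (bdiag c f) p q = (if p = q then f else 0\<^sub>m m n)"
  using assms by (auto simp: bdiag_def block_block_mat)

lemma block_diag_mult:
  fixes f :: "'a::comm_semiring_0 mat"
  assumes "f \<in> carrier_mat m n" "A \<in> carrier_mat (c * n) (e * l)" "p < c" "q < e"
  shows "block m l (bdiag c f * A) p q = f * block n l A p q"
proof (intro eq_matI, goal_cases)
  case (1 i j)
  then have ij: "i < m" "j < l" using assms by auto
  have "block m l (bdiag c f * A) p q $$ (i, j)
      = (\<Sum>t<c. (block m n (bdiag c f) p t * block n l A t q) $$ (i, j))"
    using assms ij by (intro block_mult_index) auto
  also have "\<dots> = (\<Sum>t<c. if p = t then (f * block n l A p q) $$ (i, j) else 0)"
    using assms ij by (intro sum.cong refl) (auto simp: block_bdiag)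
  finally show ?case using assms by simp
qed (use assms in auto)

lemma block_mult_diag:
  fixes f :: "'a::comm_semiring_0 mat"
  assumes "f \<in> carrier_mat m n" "A \<in> carrier_mat (e * l) (c * m)" "p < e" "q < c"
  shows "block l n (A * bdiag c f) p q = block l m A p q * f"
proof (intro eq_matI, goal_cases)
  case (1 i j)
  then have ij: "i < l" "j < n" using assms by auto
  have "block l n (A * bdiag c f) p q $$ (i, j)
      = (\<Sum>t<c. (block l m A p t * block m n (bdiag c f) t q) $$ (i, j))"
    using assms ij by (intro block_mult_index) auto
  also have "\<dots> = (\<Sum>t<c. if t = q then (block l m A p q * f) $$ (i, j) else 0)"
    using assms ij by (intro sum.cong refl) (auto simp: block_bdiag)
  finally show ?case using assms by simp
qed (use assms in auto)

lemma vblock_diag_mult: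
  fixes f :: "'a::comm_semiring_0 mat"
  assumes "f \<in> carrier_mat m n" "v \<in> carrier_vec (c * n)" "p < c"
  shows "vblock m (bdiag c f *\<^sub>v v) p = f *\<^sub>v vblock n v p"
proof (intro eq_vecI, goal_cases)
  case (1 i)
  then have i: "i < m" using assms by auto
  have "vblock m (bdiag c f *\<^sub>v v) p $ i
      = (\<Sum>t<c. (block m n (bdiag c f) p t *\<^sub>v vblock n v t) $ i)"
    using assms i by (intro vblock_mult_index) auto
  also have "\<dots> = (\<Sum>t<c. if p = t then (f *\<^sub>v vblock n v p) $ i else 0)"
    using assms i by (intro sum.cong refl) (auto simp: block_bdiag scalar_prod_def)
  finally show ?case using assms by simp
qed (use assms in auto)

lemma bdiag_one: "bdiag c (1\<^sub>m n) = 1\<^sub>m (c * n)"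
proof (rule block_eqI[where c = c and m = n and d = c and n = n])
  show "bdiag c (1\<^sub>m n) \<in> carrier_mat (c * n) (c * n)" by (rule bdiag_carrier) simp
next
  fix p q assume "p < c" "q < c"
  then show "block n n (bdiag c (1\<^sub>m n)) p q = block n n (1\<^sub>m (c * n)) p q"
    by (simp add: block_bdiag[where m = n and n = n] block_one)
qed simp

lemma bdiag_mult:
  fixes f :: "'a::comm_semiring_0 mat"
  assumes "f \<in> carrier_mat m n" "g \<in> carrier_mat n l"
  shows "bdiag c (f * g) = bdiag c f * bdiag c g"
proof (rule block_eqI[where c = c and m = m and d = c and n = l])
  show "bdiag c (f * g) \<in> carrier_mat (c * m) (c * l)"
    using assms by (intro bdiag_carrier) auto
  show "bdiag c f * bdiag c g \<in> carrier_mat (c * m) (c * l)"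
    using bdiag_carrier[OF assms(1)] bdiag_carrier[OF assms(2)] by (rule mult_carrier_mat)
next
  fix p q assume "p < c" "q < c"
  then show "block m l (bdiag c (f * g)) p q = block m l (bdiag c f * bdiag c g) p q"
    using assms
    by (auto simp: block_bdiag[OF mult_carrier_mat[OF assms]] block_bdiag[OF assms(2)]
        block_diag_mult[OF assms(1) bdiag_carrier[OF assms(2)]])
qed

lemma bdiag_add:
  assumes "f \<in> carrier_mat m n" "g \<in> carrier_mat m n"
  shows "bdiag c (f + g) = bdiag c f + bdiag c (g :: 'a::monoid_add mat)"
proof (rule block_eqI[where c = c and m = m and d = c and n = n])
  fix p q assume "p < c" "q < c"
  then show "block m n (bdiag c (f + g)) p q = block m n (bdiag c f + bdiag c g) p q"
    using assms by (auto simp: block_bdiag[where m = m and n = n] block_add[where c = c and d = c])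
qed (use assms in \<open>auto intro!: bdiag_carrier add_carrier_mat\<close>)

lemma bdiag_smult:
  assumes "f \<in> carrier_mat m n"
  shows "bdiag c (k \<cdot>\<^sub>m f) = k \<cdot>\<^sub>m bdiag c (f :: 'a::mult_zero mat)"
proof (rule block_eqI[where c = c and m = m and d = c and n = n])
  fix p q assume "p < c" "q < c"
  then show "block m n (bdiag c (k \<cdot>\<^sub>m f)) p q = block m n (k \<cdot>\<^sub>m bdiag c f) p q"
    using assms by (auto simp: block_bdiag[where m = m and n = n] block_smult[where c = c and d = c])
qed (use assms in \<open>auto intro!: bdiag_carrier\<close>)

section \<open>Modules and homomorphisms\<close>

lemma fdmodsD:
  assumes "M \<in> fdmods"
  shows act_carrier: "act M a \<in> carrier_mat (mdim M) (mdim M)"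
    and act_one: "act M 1 = 1\<^sub>m (mdim M)"
    and act_mult: "act M (a * b) = act M a * act M b"
    and act_add: "act M (a + b) = act M a + act M b"
    and act_scale: "act M (malg_scale k a) = k \<cdot>\<^sub>m act M a"
  using assms by (auto simp: fdmods_def)

lemma act_zero:
  assumes "M \<in> fdmods"
  shows "act M 0 = 0\<^sub>m (mdim M) (mdim M)"
proof -
  have "act M 0 = 0 \<cdot>\<^sub>m act M 0"
    using act_scale[OF assms, of 0 0] by (simp add: malg_scale_def)
  also have "\<dots> = 0\<^sub>m (mdim M) (mdim M)"
    using act_carrier[OF assms, of 0] by (intro eq_matI) auto
  finally show ?thesis .
qed

lemma act_sum_index:
  assumes "M \<in> fdmods" "i < mdim M" "j < mdim M"
  shows "act M (sum h A) $$ (i, j) = (\<Sum>x\<in>A. act M (h x) $$ (i, j))"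
proof (induction A rule: infinite_finite_induct)
  case (insert x A)
  then show ?case
    using assms act_carrier[OF assms(1), of "h x"] act_carrier[OF assms(1), of "sum h A"]
    by (simp add: act_add)
qed (use assms in \<open>auto simp: act_zero\<close>)

lemma fdhomD:
  assumes "f \<in> fdhom M N"
  shows "f \<in> carrier_mat (mdim N) (mdim M)" "f * act M a = act N a * f"
  using assms by (auto simp: fdhom_def)

section \<open>Linear maps as matrices, submodules, and idempotent endomorphisms\<close>

lemma mat_eq_if_mult_vec_eq:
  fixes A :: "'a::semiring_1 mat"
  assumes "A \<in> carrier_mat m n" "B \<in> carrier_mat m n"
    and "\<And>v. v \<in> carrier_vec n \<Longrightarrow> A *\<^sub>v v = B *\<^sub>v v"
  shows "A = B"
proof (rule eq_matI)
  fix i j assume "i < dim_row B" "j < dim_col B"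
  then show "A $$ (i, j) = B $$ (i, j)"
    using arg_cong[OF assms(3)[of "unit_vec n j"], of "\<lambda>v. vec_index v i"] assms(1,2)
    by (simp add: scalar_prod_right_unit)
qed (use assms in auto)

text \<open>The truncations of \<open>v\<close> to its first \<open>k\<close> coordinates are the
  partial sums of its expansion in unit vectors. Induction on \<open>k\<close> thus replaces a sum
  of vectors, and each coordinate is summed in the field.\<close>

lemma linear_map_matrix:
  fixes \<pi> :: "'k::field vec \<Rightarrow> 'k vec"
  assumes carrier: "\<And>v. v \<in> carrier_vec n \<Longrightarrow> \<pi> v \<in> carrier_vec n"
    and add: "\<And>v w. v \<in> carrier_vec n \<Longrightarrow> w \<in> carrier_vec n \<Longrightarrow> \<pi> (v + w) = \<pi> v + \<pi> w"
    and smult: "\<And>k v. v \<in> carrier_vec n \<Longrightarrow> \<pi> (k \<cdot>\<^sub>v v) = k \<cdot>\<^sub>v \<pi> v"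
  obtains P where "P \<in> carrier_mat n n" "\<And>v. v \<in> carrier_vec n \<Longrightarrow> P *\<^sub>v v = \<pi> v"
proof
  define P where "P = mat n n (\<lambda>(i, j). \<pi> (unit_vec n j) $ i)"
  show "P \<in> carrier_mat n n" by (simp add: P_def)
  fix v :: "'k vec" assume v: "v \<in> carrier_vec n"
  define trunc where "trunc k = vec n (\<lambda>j. if j < k then v $ j else 0)" for k
  have trunc_carrier: "trunc k \<in> carrier_vec n" for k by (simp add: trunc_def)
  have *: "\<pi> (trunc k) $ i = (\<Sum>j<k. v $ j * \<pi> (unit_vec n j) $ i)" if "k \<le> n" "i < n" for k i
    using \<open>k \<le> n\<close>
  proof (induction k)
    case 0
    have "trunc 0 = 0 \<cdot>\<^sub>v trunc 0" by (auto simp: trunc_def)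
    then have "\<pi> (trunc 0) = 0 \<cdot>\<^sub>v \<pi> (trunc 0)" using smult[OF trunc_carrier] by metis
    also have "\<dots> $ i = 0" using carrier[OF trunc_carrier, of 0] that by simp
    finally show ?case by simp
  next
    case (Suc k)
    have "trunc (Suc k) = trunc k + v $ k \<cdot>\<^sub>v unit_vec n k"
      using Suc.prems by (intro eq_vecI) (auto simp: trunc_def less_Suc_eq)
    then have "\<pi> (trunc (Suc k)) = \<pi> (trunc k) + v $ k \<cdot>\<^sub>v \<pi> (unit_vec n k)"
      by (simp add: add smult trunc_carrier)
    then show ?case
      using Suc that carrier[of "unit_vec n k"] carrier[OF trunc_carrier, of k] by simp
  qed
  show "P *\<^sub>v v = \<pi> v"
  proof (rule eq_vecI)
    fix i assume "i < dim_vec (\<pi> v)"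
    then have i: "i < n" using carrier[OF v] by simp
    have "trunc n = v" using v by (auto simp: trunc_def)
    then show "(P *\<^sub>v v) $ i = \<pi> v $ i"
      using *[OF order.refl i] i v
      by (simp add: P_def scalar_prod_def atLeast0LessThan mult.commute)
  qed (use carrier[OF v] in \<open>simp add: P_def\<close>)
qed

lemma fdsubmoduleD:
  assumes "fdsubmodule M W"
  shows "W \<subseteq> vecs M" "0\<^sub>v (mdim M) \<in> W" "v \<in> W \<Longrightarrow> w \<in> W \<Longrightarrow> v + w \<in> W"
    "w \<in> W \<Longrightarrow> act M a *\<^sub>v w \<in> W"
  using assms by (auto simp: fdsubmodule_def)

text \<open>The definition of a submodule mentions no scalars; the scalar \<open>k\<close> acts as
  \<open>k\<close> times the unit of the algebra.\<close>

lemma fdsubmodule_smult: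
  assumes "M \<in> fdmods" "fdsubmodule M W" "w \<in> W"
  shows "k \<cdot>\<^sub>v w \<in> W"
proof -
  have "w \<in> vecs M" using assms fdsubmoduleD(1) by blast
  then have "act M (malg_scale k 1) *\<^sub>v w = k \<cdot>\<^sub>v w"
    using assms(1) by (intro eq_vecI) (auto simp: act_scale act_one scalar_prod_left_unit)
  then show ?thesis using fdsubmoduleD(4)[OF assms(2,3)] by metis
qed

lemma fdsubmodule_diff:
  assumes "M \<in> fdmods" "fdsubmodule M W" "v \<in> W" "w \<in> W"
  shows "v - w \<in> W"
proof -
  have "v \<in> vecs M" "w \<in> vecs M" using assms fdsubmoduleD(1) by blast+
  then have "v - w = v + (-1) \<cdot>\<^sub>v w" by (intro eq_vecI) auto
  then show ?thesis
    using fdsubmodule_smult[OF assms(1,2,4)] fdsubmoduleD(3)[OF assms(2,3)] by metis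
qed

text \<open>Turns a decomposition into an endomorphism, to which the description of homomorphisms by
  blocks applies. The projection is well defined since \<open>W\<close> and \<open>W'\<close> meet
  in 0, and it is a homomorphism since both are submodules.\<close>

lemma direct_sum_projection:
  assumes M: "M \<in> fdmods" and W: "fdsubmodule M W" "fdsubmodule M W'"
    and int: "W \<inter> W' = {0\<^sub>v (mdim M)}" and sum: "{w + w' | w w'. w \<in> W \<and> w' \<in> W'} = vecs M"
  obtains P where "P \<in> fdhom M M" "\<And>w. w \<in> W \<Longrightarrow> P *\<^sub>v w = w"
    "\<And>w'. w' \<in> W' \<Longrightarrow> P *\<^sub>v w' = 0\<^sub>v (mdim M)"
proof -
  let ?n = "mdim M"
  have WM: "w \<in> vecs M" if "w \<in> W" for w using that W fdsubmoduleD(1) by blast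
  have WM': "w \<in> vecs M" if "w \<in> W'" for w using that W fdsubmoduleD(1) by blast
  have unique: "w1 = w2"
    if "w1 \<in> W" "w2 \<in> W" "w1' \<in> W'" "w2' \<in> W'" "w1 + w1' = w2 + w2'" for w1 w2 w1' w2'
  proof -
    have c: "w1 \<in> vecs M" "w2 \<in> vecs M" "w1' \<in> vecs M" "w2' \<in> vecs M"
      using that WM WM' by auto
    have e: "w1 $ i + w1' $ i = w2 $ i + w2' $ i" if "i < ?n" for i
      using arg_cong[OF \<open>w1 + w1' = w2 + w2'\<close>, of "\<lambda>v. vec_index v i"] c that by simp
    have "w1 - w2 = w2' - w1'"
      using c e by (intro eq_vecI) (auto simp: diff_eq_eq eq_diff_eq algebra_simps)
    then have "w1 - w2 \<in> W \<inter> W'"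
      using fdsubmodule_diff[OF M W(1) that(1,2)] fdsubmodule_diff[OF M W(2) that(4,3)] by simp
    then have diff: "w1 - w2 = 0\<^sub>v ?n" using int by auto
    have "w1 $ i = w2 $ i" if "i < ?n" for i
      using arg_cong[OF diff, of "\<lambda>v. vec_index v i"] c that by simp
    then show "w1 = w2" using c by (intro eq_vecI) auto
  qed
  \<comment> \<open>By \<open>unique\<close>, the summand in \<open>W\<close> is determined by
    \<open>v\<close>, so the choice is no choice.\<close>
  define \<pi> where "\<pi> v = (SOME w. w \<in> W \<and> (\<exists>w' \<in> W'. v = w + w'))" for v
  have \<pi>_eq: "\<pi> (w + w') = w" if "w \<in> W" "w' \<in> W'" for w w'
    unfolding \<pi>_def by (rule some_equality) (use that unique in blast)+
  have decomp: "\<exists>w \<in> W. \<exists>w' \<in> W'. v = w + w'" if "v \<in> vecs M" for v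
    using that sum by blast
  have \<pi>_carrier: "\<pi> v \<in> vecs M" if "v \<in> vecs M" for v
    using decomp[OF that] \<pi>_eq WM by auto
  have \<pi>_add: "\<pi> (v + u) = \<pi> v + \<pi> u" if vu: "v \<in> vecs M" "u \<in> vecs M" for v u
  proof -
    from decomp vu obtain w w' x x' where
      *: "w \<in> W" "w' \<in> W'" "v = w + w'" "x \<in> W" "x' \<in> W'" "u = x + x'" by meson
    then have "v + u = (w + x) + (w' + x')"
      using WM[OF *(1)] WM'[OF *(2)] WM[OF *(4)] WM'[OF *(5)] by (intro eq_vecI) auto
    then show ?thesis
      using * \<pi>_eq fdsubmoduleD(3)[OF W(1)] fdsubmoduleD(3)[OF W(2)] by simp
  qed
  have \<pi>_smult: "\<pi> (k \<cdot>\<^sub>v v) = k \<cdot>\<^sub>v \<pi> v" if "v \<in> vecs M" for k v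
  proof -
    from decomp that obtain w w' where *: "w \<in> W" "w' \<in> W'" "v = w + w'" by meson
    then have "k \<cdot>\<^sub>v v = k \<cdot>\<^sub>v w + k \<cdot>\<^sub>v w'"
      using smult_add_distrib_vec WM WM' by metis
    then show ?thesis
      using * \<pi>_eq fdsubmodule_smult[OF M W(1)] fdsubmodule_smult[OF M W(2)] by simp
  qed
  have \<pi>_act: "\<pi> (act M a *\<^sub>v v) = act M a *\<^sub>v \<pi> v" if "v \<in> vecs M" for a v
  proof -
    from decomp that obtain w w' where *: "w \<in> W" "w' \<in> W'" "v = w + w'" by meson
    then have "act M a *\<^sub>v v = act M a *\<^sub>v w + act M a *\<^sub>v w'"
      using mult_add_distrib_mat_vec[OF act_carrier[OF M]] WM WM' by metis
    then show ?thesis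
      using * \<pi>_eq fdsubmoduleD(4)[OF W(1)] fdsubmoduleD(4)[OF W(2)] by simp
  qed
  obtain P where P: "P \<in> carrier_mat ?n ?n" "\<And>v. v \<in> vecs M \<Longrightarrow> P *\<^sub>v v = \<pi> v"
    using linear_map_matrix[OF \<pi>_carrier \<pi>_add \<pi>_smult] by blast
  have "P * act M a = act M a * P" for a
  proof (rule mat_eq_if_mult_vec_eq[of _ ?n ?n])
    fix v :: "'b vec" assume v: "v \<in> carrier_vec ?n"
    have "act M a *\<^sub>v v \<in> vecs M" using act_carrier[OF M] v by (rule mult_mat_vec_carrier)
    then show "(P * act M a) *\<^sub>v v = (act M a * P) *\<^sub>v v"
      using assoc_mult_mat_vec[OF P(1) act_carrier[OF M, of a] v]
        assoc_mult_mat_vec[OF act_carrier[OF M, of a] P(1) v] \<pi>_act[OF v, of a] P(2) v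
      by simp
  qed (use P(1) act_carrier[OF M, of a] in auto)
  then have "P \<in> fdhom M M" using P(1) by (simp add: fdhom_def)
  moreover have "P *\<^sub>v w = w" if "w \<in> W" for w
    using \<pi>_eq[OF that fdsubmoduleD(2)[OF W(2)]] WM[OF that] P(2) by simp
  moreover have "P *\<^sub>v w' = 0\<^sub>v ?n" if "w' \<in> W'" for w'
    using \<pi>_eq[OF fdsubmoduleD(2)[OF W(1)] that] WM'[OF that] P(2) by simp
  ultimately show thesis using that by blast
qed

text \<open>The fixed vectors and the kernel of \<open>f\<close> are complementary submodules, by
  \<open>v = f v + (v - f v)\<close>; if the first is zero then \<open>f = 0\<close>, if the second
  is zero then \<open>f = 1\<close>.\<close>

lemma idempotent_endo_indecomposable:
  assumes M: "M \<in> fdmods" "indecomposable M" and f: "f \<in> fdhom M M" "f * f = f"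
  shows "f = 0\<^sub>m (mdim M) (mdim M) \<or> f = 1\<^sub>m (mdim M)"
proof -
  let ?n = "mdim M"
  have fc: "f \<in> carrier_mat ?n ?n" using fdhomD(1)[OF f(1)] .
  have ff: "f *\<^sub>v (f *\<^sub>v v) = f *\<^sub>v v" if "v \<in> vecs M" for v
    using assoc_mult_mat_vec[OF fc fc that] f(2) by simp
  have fact: "f *\<^sub>v (act M a *\<^sub>v v) = act M a *\<^sub>v (f *\<^sub>v v)" if "v \<in> vecs M" for a v
    using assoc_mult_mat_vec[OF fc act_carrier[OF M(1)] that, of a]
      assoc_mult_mat_vec[OF act_carrier[OF M(1)] fc that, of a] fdhomD(2)[OF f(1)] by simp
  have ac: "act M a *\<^sub>v v \<in> vecs M" if "v \<in> vecs M" for a v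
    using act_carrier[OF M(1)] that by (rule mult_mat_vec_carrier)
  have fv: "f *\<^sub>v v \<in> vecs M" if "v \<in> vecs M" for v
    using fc that by (rule mult_mat_vec_carrier)
  have f0: "f *\<^sub>v 0\<^sub>v ?n = 0\<^sub>v ?n" "act M a *\<^sub>v 0\<^sub>v ?n = 0\<^sub>v ?n" for a
    using fc act_carrier[OF M(1), of a] by auto
  have fdiff: "f *\<^sub>v (v - f *\<^sub>v v) = 0\<^sub>v ?n" if "v \<in> vecs M" for v
    using mult_minus_distrib_mat_vec[OF fc that fv[OF that]] ff[OF that] fv[OF that] by simp
  define W where "W = {v \<in> vecs M. f *\<^sub>v v = v}"
  define W' where "W' = {v \<in> vecs M. f *\<^sub>v v = 0\<^sub>v ?n}"
  have "fdsubmodule M W" "fdsubmodule M W'"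
    using mult_add_distrib_mat_vec[OF fc] fact ac f0
    by (auto simp: fdsubmodule_def W_def W'_def)
  moreover have "W \<inter> W' = {0\<^sub>v ?n}"
    using f0 by (auto simp: W_def W'_def)
  moreover have "{w + w' | w w'. w \<in> W \<and> w' \<in> W'} = vecs M"
  proof (intro equalityI subsetI)
    fix v assume v: "v \<in> vecs M"
    then have "f *\<^sub>v v \<in> W" "v - f *\<^sub>v v \<in> W'" "v = f *\<^sub>v v + (v - f *\<^sub>v v)"
      using fv[OF v] ff[OF v] fdiff[OF v] fc by (auto simp: W_def W'_def)
    then show "v \<in> {w + w' | w w'. w \<in> W \<and> w' \<in> W'}" by blast
  qed (auto simp: W_def W'_def)
  ultimately consider "W = {0\<^sub>v ?n}" | "W' = {0\<^sub>v ?n}"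
    using M(2) unfolding indecomposable_def by blast
  then show ?thesis
  proof cases
    case 1
    have "f *\<^sub>v v = 0\<^sub>m ?n ?n *\<^sub>v v" if "v \<in> vecs M" for v
    proof -
      have "f *\<^sub>v v \<in> W" using ff fv that by (simp add: W_def)
      then show ?thesis using 1 that by (auto intro!: eq_vecI)
    qed
    then show ?thesis using mat_eq_if_mult_vec_eq[OF fc] by auto
  next
    case 2
    have "f *\<^sub>v v = 1\<^sub>m ?n *\<^sub>v v" if "v \<in> vecs M" for v
    proof -
      have "v - f *\<^sub>v v \<in> W'" using fdiff fv that by (simp add: W'_def)
      then have *: "v - f *\<^sub>v v = 0\<^sub>v ?n" using 2 by simp
      have "v $ i = (f *\<^sub>v v) $ i" if "i < ?n" for i
        using arg_cong[OF *, of "\<lambda>x. vec_index x i"] that fc \<open>v \<in> vecs M\<close> by simp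
      then show ?thesis using that fc by (intro eq_vecI) auto
    qed
    then show ?thesis using mat_eq_if_mult_vec_eq[OF fc] by auto
  qed
qed

section \<open>The functor given by an algebra homomorphism into a matrix algebra\<close>

text \<open>\<open>S\<close> is a homomorphism from one monoid algebra to the \<open>c\<close> by
  \<open>c\<close> matrices over another one, B. The module \<open>induced M\<close> is B^c tensored
  with \<open>M\<close> over B; as B^c is free over B, this functor is exact.\<close>

locale matrix_algebra_hom =
  fixes c :: nat
    and S :: "('m::monoid_add \<Rightarrow>\<^sub>0 'k::field) \<Rightarrow> nat \<Rightarrow> nat \<Rightarrow> ('l::monoid_add \<Rightarrow>\<^sub>0 'k)"
  assumes S_one: "p < c \<Longrightarrow> q < c \<Longrightarrow> S 1 p q = (if p = q then 1 else 0)"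
    and S_mult: "p < c \<Longrightarrow> q < c \<Longrightarrow> S (a * b) p q = (\<Sum>t<c. S a p t * S b t q)"
    and S_add: "p < c \<Longrightarrow> q < c \<Longrightarrow> S (a + b) p q = S a p q + S b p q"
    and S_scale: "p < c \<Longrightarrow> q < c \<Longrightarrow> S (malg_scale k a) p q = malg_scale k (S a p q)"
begin

definition induced :: "('l, 'k) fdmod \<Rightarrow> ('m, 'k) fdmod" where
  "induced M = \<lparr>mdim = c * mdim M,
     act = \<lambda>a. block_mat (mdim M) c (mdim M) c (\<lambda>p q. act M (S a p q))\<rparr>"

lemma mdim_induced [simp]: "mdim (induced M) = c * mdim M"
  by (simp add: induced_def)

lemma act_induced_carrier [simp]:
  "act (induced M) a \<in> carrier_mat (c * mdim M) (c * mdim M)"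
  by (simp add: induced_def)

lemma block_act_induced:
  assumes "M \<in> fdmods" "p < c" "q < c"
  shows "block (mdim M) (mdim M) (act (induced M) a) p q = act M (S a p q)"
  using assms by (simp add: induced_def block_block_mat act_carrier)

lemma induced_fdmods:
  assumes M: "M \<in> fdmods"
  shows "induced M \<in> fdmods"
proof -
  let ?n = "mdim M" and ?F = "act (induced M)"
  note eqI = block_eqI[where c = c and m = ?n and d = c and n = ?n]
  have "?F 1 = 1\<^sub>m (c * ?n)"
    by (rule eqI) (simp_all add: block_act_induced[OF M] S_one block_one act_one[OF M] act_zero[OF M])
  moreover have "?F (a * b) = ?F a * ?F b" for a b
  proof (rule eqI)
    fix p q assume pq: "p < c" "q < c"
    show "block ?n ?n (?F (a * b)) p q = block ?n ?n (?F a * ?F b) p q"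
    proof (rule eq_matI, goal_cases)
      case (1 i j)
      then have ij: "i < ?n" "j < ?n" by simp_all
      have "block ?n ?n (?F a * ?F b) p q $$ (i, j)
          = (\<Sum>t<c. (block ?n ?n (?F a) p t * block ?n ?n (?F b) t q) $$ (i, j))"
        using pq ij by (intro block_mult_index) auto
      also have "\<dots> = (\<Sum>t<c. act M (S a p t * S b t q) $$ (i, j))"
        using pq by (intro sum.cong refl) (simp add: block_act_induced[OF M] act_mult[OF M])
      also have "\<dots> = block ?n ?n (?F (a * b)) p q $$ (i, j)"
        using pq ij by (simp add: block_act_induced[OF M] S_mult act_sum_index[OF M])
      finally show ?case by simp
    qed simp_all
  qed (rule mult_carrier_mat[OF act_induced_carrier act_induced_carrier] act_induced_carrier)+
  moreover have "?F (a + b) = ?F a + ?F b" for a b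
    by (rule eqI) (auto simp: block_act_induced[OF M] S_add act_add[OF M] intro!: add_carrier_mat
        simp: block_add[OF act_induced_carrier act_induced_carrier])
  moreover have "?F (malg_scale k a) = k \<cdot>\<^sub>m ?F a" for k a
    by (rule eqI) (auto simp: block_act_induced[OF M] S_scale act_scale[OF M]
        block_smult[OF act_induced_carrier])
  ultimately show ?thesis by (simp add: fdmods_def)
qed

lemma bdiag_fdhom:
  assumes M: "M \<in> fdmods" and N: "N \<in> fdmods" and f: "f \<in> fdhom M N"
  shows "bdiag c f \<in> fdhom (induced M) (induced N)"
proof -
  have fc: "f \<in> carrier_mat (mdim N) (mdim M)" using f by (rule fdhomD)
  have "bdiag c f * act (induced M) a = act (induced N) a * bdiag c f" for a
  proof (rule block_eqI[where c = c and m = "mdim N" and d = c and n = "mdim M"])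
    show "bdiag c f * act (induced M) a \<in> carrier_mat (c * mdim N) (c * mdim M)"
      using bdiag_carrier[OF fc] act_induced_carrier by (rule mult_carrier_mat)
    show "act (induced N) a * bdiag c f \<in> carrier_mat (c * mdim N) (c * mdim M)"
      using act_induced_carrier bdiag_carrier[OF fc] by (rule mult_carrier_mat)
  next
    fix p q assume pq: "p < c" "q < c"
    then show "block (mdim N) (mdim M) (bdiag c f * act (induced M) a) p q
        = block (mdim N) (mdim M) (act (induced N) a * bdiag c f) p q"
      by (simp add: block_diag_mult[OF fc act_induced_carrier pq] fdhomD(2)[OF f]
          block_mult_diag[OF fc act_induced_carrier pq] block_act_induced M N)
  qed
  then show ?thesis using bdiag_carrier[OF fc] by (simp add: fdhom_def)
qed

text \<open>Injectivity, kernel and image of a block diagonal map are decided in each block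
  separately. Preimages are chosen block by block in \<open>lift\<close>, which serves both the
  middle and the right end of the sequence.\<close>

lemma bdiag_short_exact:
  assumes mods: "L \<in> fdmods" "M \<in> fdmods" "N \<in> fdmods" and ex: "short_exact L M N f g"
  shows "short_exact (induced L) (induced M) (induced N) (bdiag c f) (bdiag c g)"
proof -
  have f: "f \<in> fdhom L M" and g: "g \<in> fdhom M N"
    and inj: "inj_on (\<lambda>v. f *\<^sub>v v) (vecs L)"
    and ker: "(\<lambda>v. f *\<^sub>v v) ` vecs L = {v \<in> vecs M. g *\<^sub>v v = 0\<^sub>v (mdim N)}"
    and surj: "(\<lambda>v. g *\<^sub>v v) ` vecs M = vecs N"
    using ex by (auto simp: short_exact_def)
  note fc = fdhomD(1)[OF f] and gc = fdhomD(1)[OF g]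
  note fC = bdiag_carrier[OF fc, of c] and gC = bdiag_carrier[OF gc, of c]
  have lift: "\<exists>v \<in> carrier_vec (c * n). bdiag c h *\<^sub>v v = w"
    if h: "h \<in> carrier_mat m n" and w: "w \<in> carrier_vec (c * m)"
      and im: "\<And>p. p < c \<Longrightarrow> vblock m w p \<in> (\<lambda>v. h *\<^sub>v v) ` carrier_vec n" for h m n and w :: "'k vec"
  proof -
    obtain u where u: "\<And>p. p < c \<Longrightarrow> u p \<in> carrier_vec n \<and> h *\<^sub>v u p = vblock m w p"
      using im unfolding image_iff by metis
    have "bdiag c h *\<^sub>v block_vec n c u = w"
    proof (rule vblock_eqI[where c = c and n = m])
      show "bdiag c h *\<^sub>v block_vec n c u \<in> carrier_vec (c * m)"
        using bdiag_carrier[OF h] block_vec_carrier by (rule mult_mat_vec_carrier)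
      fix p assume p: "p < c"
      then show "vblock m (bdiag c h *\<^sub>v block_vec n c u) p = vblock m w p"
        using u by (simp add: vblock_diag_mult[OF h block_vec_carrier p] vblock_block_vec)
    qed (rule w)
    then show ?thesis by (intro bexI[OF _ block_vec_carrier])
  qed
  have zero: "vblock m (0\<^sub>v (c * m) :: 'k vec) p = 0\<^sub>v m" if "p < c" for p m
    using that by (intro eq_vecI) (auto simp: vblock_index block_index_less)
  have "inj_on (\<lambda>v. bdiag c f *\<^sub>v v) (vecs (induced L))"
  proof (rule inj_onI)
    fix v w assume vw: "v \<in> vecs (induced L)" "w \<in> vecs (induced L)"
      and eq: "bdiag c f *\<^sub>v v = bdiag c f *\<^sub>v w"
    show "v = w"
    proof (rule vblock_eqI[where c = c and n = "mdim L"])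
      fix p assume "p < c"
      then have "f *\<^sub>v vblock (mdim L) v p = f *\<^sub>v vblock (mdim L) w p"
        using vblock_diag_mult[OF fc] vw eq by (metis mdim_induced)
      then show "vblock (mdim L) v p = vblock (mdim L) w p"
        using inj by (auto dest: inj_onD)
    qed (use vw in auto)
  qed
  moreover have "(\<lambda>v. bdiag c f *\<^sub>v v) ` vecs (induced L)
      = {v \<in> vecs (induced M). bdiag c g *\<^sub>v v = 0\<^sub>v (mdim (induced N))}" (is "?I = ?K")
  proof (intro equalityI subsetI)
    fix w assume "w \<in> ?I"
    then obtain v where v: "v \<in> carrier_vec (c * mdim L)" "w = bdiag c f *\<^sub>v v" by auto
    have wc: "w \<in> carrier_vec (c * mdim M)"
      unfolding v(2) using fC v(1) by (rule mult_mat_vec_carrier)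
    have "bdiag c g *\<^sub>v w = 0\<^sub>v (c * mdim N)"
    proof (rule vblock_eqI[where c = c and n = "mdim N"])
      show "bdiag c g *\<^sub>v w \<in> carrier_vec (c * mdim N)" using gC wc by (rule mult_mat_vec_carrier)
      fix p assume p: "p < c"
      have "f *\<^sub>v vblock (mdim L) v p \<in> {v \<in> vecs M. g *\<^sub>v v = 0\<^sub>v (mdim N)}"
        using ker by (metis imageI vblock_carrier)
      then show "vblock (mdim N) (bdiag c g *\<^sub>v w) p = vblock (mdim N) (0\<^sub>v (c * mdim N)) p"
        using p by (simp add: vblock_diag_mult[OF gc wc p] zero)
          (simp add: v(2) vblock_diag_mult[OF fc v(1) p])
    qed simp
    then show "w \<in> ?K" using wc by simp
  next
    fix w assume "w \<in> ?K"
    then have w: "w \<in> carrier_vec (c * mdim M)" "bdiag c g *\<^sub>v w = 0\<^sub>v (c * mdim N)" by auto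
    have "vblock (mdim M) w p \<in> (\<lambda>v. f *\<^sub>v v) ` vecs L" if p: "p < c" for p
      unfolding ker using vblock_diag_mult[OF gc w(1) p] w(2) zero[OF p] by simp
    then show "w \<in> ?I" using lift[OF fc w(1)] by force
  qed
  moreover have "(\<lambda>v. bdiag c g *\<^sub>v v) ` vecs (induced M) = vecs (induced N)"
  proof (intro equalityI subsetI)
    fix w assume "w \<in> vecs (induced N)"
    then show "w \<in> (\<lambda>v. bdiag c g *\<^sub>v v) ` vecs (induced M)"
      using lift[OF gc, of w] surj by force
  qed (use gC mult_mat_vec_carrier in force)
  ultimately show ?thesis
    using bdiag_fdhom f g mods unfolding short_exact_def by blast
qed

lemma exact_linear_functor_induced: "exact_linear_functor induced (\<lambda>M N. bdiag c)"
  unfolding exact_linear_functor_def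
proof (intro conjI ballI allI impI)
  fix M :: "('l, 'k) fdmod"
  show "bdiag c (1\<^sub>m (mdim M)) = 1\<^sub>m (mdim (induced M))" by (simp add: bdiag_one)
qed (auto simp: induced_fdmods bdiag_fdhom bdiag_short_exact
    intro: bdiag_mult bdiag_add bdiag_smult dest!: fdhomD(1))

end

text \<open>
  Fullness up to the ideal of homomorphisms whose only nonzero blocks have row index at least \<open>b\<close>
  and column index less than \<open>b\<close>; this ideal has square zero.
\<close>

locale almost_full_matrix_algebra_hom = matrix_algebra_hom +
  fixes b :: nat
  assumes b_pos: "0 < b" and b_le: "b \<le> c"
    and almost_full: "M \<in> fdmods \<Longrightarrow> N \<in> fdmods \<Longrightarrow> \<Phi> \<in> fdhom (induced M) (induced N) \<Longrightarrow>
      \<exists>f \<in> fdhom M N. \<forall>p<c. \<forall>q<c. \<not> (b \<le> p \<and> q < b) \<longrightarrow>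
        block (mdim N) (mdim M) \<Phi> p q = (if p = q then f else 0\<^sub>m (mdim N) (mdim M))"
begin

lemma c_pos: "0 < c"
  using b_pos b_le by simp

text \<open>Since 0 < \<open>b\<close>, row 0 of a homomorphism between induced modules has no
  nonzero block off the diagonal. Taking the block at (0, 0) is therefore multiplicative on such
  homomorphisms.\<close>

lemma corner_block_mult:
  assumes A: "A \<in> carrier_mat (c * l) (c * m)" and B: "B \<in> carrier_mat (c * m) (c * n)"
    and A0: "\<And>t. 0 < t \<Longrightarrow> t < c \<Longrightarrow> block l m A 0 t = 0\<^sub>m l m"
  shows "block l n (A * B) 0 0 = block l m A 0 0 * block m n (B :: 'b::field mat) 0 0"
proof (rule eq_matI, goal_cases)
  case (1 i j)
  then have ij: "i < l" "j < n" by simp_all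
  have "block l n (A * B) 0 0 $$ (i, j) = (\<Sum>t<c. (block l m A 0 t * block m n B t 0) $$ (i, j))"
    using c_pos ij by (intro block_mult_index[OF A B]) auto
  also have "\<dots> = (\<Sum>t<c. if t = 0 then (block l m A 0 0 * block m n B 0 0) $$ (i, j) else 0)"
    using A0 ij by (intro sum.cong refl) auto
  finally show ?case using c_pos by simp
qed simp_all

text \<open>An idempotent in a square-zero ideal equals its square, hence vanishes: a middle index
  \<open>t\<close> with both factors nonzero would have to be less than \<open>b\<close> and at
  least \<open>b\<close>.\<close>

lemma corner_nilpotent:
  assumes P: "P \<in> carrier_mat (c * n) (c * n)" and PP: "P * P = (P :: 'b::field mat)"
    and corner: "\<And>p q. p < c \<Longrightarrow> q < c \<Longrightarrow> \<not> (b \<le> p \<and> q < b) \<Longrightarrow> block n n P p q = 0\<^sub>m n n"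
  shows "P = 0\<^sub>m (c * n) (c * n)"
proof (rule block_eqI[OF P])
  fix p q assume pq: "p < c" "q < c"
  have zero: "block n n (0\<^sub>m (c * n) (c * n) :: 'b mat) p q = 0\<^sub>m n n"
    using pq by (intro eq_matI) (auto simp: block_index block_index_less)
  have "block n n P p q = 0\<^sub>m n n"
  proof (rule eq_matI)
    fix i j assume "i < dim_row (0\<^sub>m n n)" "j < dim_col (0\<^sub>m n n)"
    then have ij: "i < n" "j < n" by simp_all
    have "block n n P p q $$ (i, j) = (\<Sum>t<c. (block n n P p t * block n n P t q) $$ (i, j))"
      using block_mult_index[OF P P pq ij] PP by simp
    also have "\<dots> = 0"
    proof (rule sum.neutral, rule ballI)
      fix t assume "t \<in> {..<c}"
      then show "(block n n P p t * block n n P t q) $$ (i, j) = 0"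
        using corner[of p t] corner[of t q] pq ij by (cases "t < b") (auto simp: not_le)
    qed
    finally show "block n n P p q $$ (i, j) = 0\<^sub>m n n $$ (i, j)" using ij by simp
  qed simp_all
  then show "block n n P p q = block n n (0\<^sub>m (c * n) (c * n)) p q" using zero by simp
qed simp

lemma almost_fullE:
  assumes "M \<in> fdmods" "N \<in> fdmods" "\<Phi> \<in> fdhom (induced M) (induced N)"
  obtains f where "f \<in> fdhom M N" "\<And>p q. p < c \<Longrightarrow> q < c \<Longrightarrow> \<not> (b \<le> p \<and> q < b) \<Longrightarrow>
      block (mdim N) (mdim M) \<Phi> p q = (if p = q then f else 0\<^sub>m (mdim N) (mdim M))"
  using almost_full[OF assms] by blast

text \<open>The blocks at (0, 0) of two mutually inverse homomorphisms are mutually inverse.\<close>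

lemma induced_reflects_iso:
  assumes M: "M \<in> fdmods" and N: "N \<in> fdmods" and iso: "isomorphic (induced M) (induced N)"
  shows "isomorphic M N"
proof -
  obtain \<Phi> \<Psi> where \<Phi>: "\<Phi> \<in> fdhom (induced M) (induced N)" and \<Psi>: "\<Psi> \<in> fdhom (induced N) (induced M)"
    and inv: "\<Psi> * \<Phi> = 1\<^sub>m (c * mdim M)" "\<Phi> * \<Psi> = 1\<^sub>m (c * mdim N)"
    using iso unfolding isomorphic_def by auto
  obtain f where f: "f \<in> fdhom M N" "\<And>p q. p < c \<Longrightarrow> q < c \<Longrightarrow> \<not> (b \<le> p \<and> q < b) \<Longrightarrow>
      block (mdim N) (mdim M) \<Phi> p q = (if p = q then f else 0\<^sub>m (mdim N) (mdim M))"
    using almost_fullE[OF M N \<Phi>] by blast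
  obtain g where g: "g \<in> fdhom N M" "\<And>p q. p < c \<Longrightarrow> q < c \<Longrightarrow> \<not> (b \<le> p \<and> q < b) \<Longrightarrow>
      block (mdim M) (mdim N) \<Psi> p q = (if p = q then g else 0\<^sub>m (mdim M) (mdim N))"
    using almost_fullE[OF N M \<Psi>] by blast
  have c: "\<Phi> \<in> carrier_mat (c * mdim N) (c * mdim M)" "\<Psi> \<in> carrier_mat (c * mdim M) (c * mdim N)"
    using fdhomD(1)[OF \<Phi>] fdhomD(1)[OF \<Psi>] by simp_all
  have "g * f = 1\<^sub>m (mdim M)"
    using corner_block_mult[OF c(2,1)] inv(1) f(2) g(2) c_pos b_pos by (simp add: block_one)
  moreover have "f * g = 1\<^sub>m (mdim N)"
    using corner_block_mult[OF c] inv(2) f(2) g(2) c_pos b_pos by (simp add: block_one)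
  ultimately show ?thesis
    using f(1) g(1) unfolding isomorphic_def by blast
qed

text \<open>The projection \<open>P\<close> of a decomposition has an idempotent \<open>f\<close> as
  its diagonal blocks, and \<open>f\<close> is 0 or 1 because \<open>M\<close> is indecomposable.
  Then \<open>P\<close> or \<open>1 - P\<close> is an idempotent in the square-zero ideal, hence
  0.\<close>

lemma induced_indecomposable:
  assumes M: "M \<in> fdmods" and ind: "indecomposable M"
  shows "indecomposable (induced M)"
  unfolding indecomposable_def
proof (intro conjI allI impI)
  show "mdim (induced M) \<noteq> 0" using ind c_pos by (simp add: indecomposable_def)
next
  let ?n = "mdim M"
  fix W W'
  assume *: "fdsubmodule (induced M) W \<and> fdsubmodule (induced M) W' \<and>
    W \<inter> W' = {0\<^sub>v (mdim (induced M))} \<and> {w + w' | w w'. w \<in> W \<and> w' \<in> W'} = vecs (induced M)"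
  then obtain P where P: "P \<in> fdhom (induced M) (induced M)" "\<And>w. w \<in> W \<Longrightarrow> P *\<^sub>v w = w"
    "\<And>w'. w' \<in> W' \<Longrightarrow> P *\<^sub>v w' = 0\<^sub>v (c * ?n)"
    using direct_sum_projection[OF induced_fdmods[OF M], of W W'] by auto
  have W: "W \<subseteq> carrier_vec (c * ?n)" "W' \<subseteq> carrier_vec (c * ?n)"
    "0\<^sub>v (c * ?n) \<in> W" "0\<^sub>v (c * ?n) \<in> W'"
    using * by (auto simp: fdsubmodule_def)
  have Pc: "P \<in> carrier_mat (c * ?n) (c * ?n)" using fdhomD(1)[OF P(1)] by simp
  have PP: "P * P = P"
  proof (rule mat_eq_if_mult_vec_eq[OF mult_carrier_mat[OF Pc Pc] Pc])
    fix v :: "'b vec" assume "v \<in> carrier_vec (c * ?n)"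
    then have "v \<in> {w + w' | w w'. w \<in> W \<and> w' \<in> W'}" using * by simp
    then obtain w w' where w: "w \<in> W" "w' \<in> W'" "v = w + w'" by blast
    then have wc: "w \<in> carrier_vec (c * ?n)" "w' \<in> carrier_vec (c * ?n)" using W by auto
    have "P *\<^sub>v v = w"
      using mult_add_distrib_mat_vec[OF Pc wc] P(2)[OF w(1)] P(3)[OF w(2)] w(3) wc by simp
    moreover have "v \<in> carrier_vec (c * ?n)" using w(3) wc by simp
    ultimately show "(P * P) *\<^sub>v v = P *\<^sub>v v"
      using assoc_mult_mat_vec[OF Pc Pc] P(2)[OF w(1)] by simp
  qed
  obtain f where f: "f \<in> fdhom M M" "\<And>p q. p < c \<Longrightarrow> q < c \<Longrightarrow> \<not> (b \<le> p \<and> q < b) \<Longrightarrow>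
      block ?n ?n P p q = (if p = q then f else 0\<^sub>m ?n ?n)"
    using almost_fullE[OF M M P(1)] by blast
  have "f * f = f"
    using corner_block_mult[OF Pc Pc] PP f(2) c_pos b_pos by simp
  then consider "f = 0\<^sub>m ?n ?n" | "f = 1\<^sub>m ?n"
    using idempotent_endo_indecomposable[OF M ind f(1)] by blast
  then show "W = {0\<^sub>v (mdim (induced M))} \<or> W' = {0\<^sub>v (mdim (induced M))}"
  proof cases
    case 1
    then have "P = 0\<^sub>m (c * ?n) (c * ?n)"
      using corner_nilpotent[OF Pc PP] f(2) by auto
    then have "P *\<^sub>v w = 0\<^sub>v (c * ?n)" if "w \<in> carrier_vec (c * ?n)" for w
      using that by (auto intro!: eq_vecI)
    then have "W \<subseteq> {0\<^sub>v (c * ?n)}"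
      using P(2) W(1) by (metis singletonI subsetD subsetI)
    then have "W = {0\<^sub>v (c * ?n)}" using W(3) by blast
    then show ?thesis by simp
  next
    case 2
    define Q where "Q = 1\<^sub>m (c * ?n) - P"
    have Qc: "Q \<in> carrier_mat (c * ?n) (c * ?n)" using Pc by (simp add: Q_def minus_carrier_mat)
    have Qv: "Q *\<^sub>v v = v - P *\<^sub>v v" if "v \<in> carrier_vec (c * ?n)" for v
      using minus_mult_distrib_mat_vec[OF one_carrier_mat Pc that] that by (simp add: Q_def)
    have "Q * P = 1\<^sub>m (c * ?n) * P - P * P"
      unfolding Q_def by (rule minus_mult_distrib_mat[OF one_carrier_mat Pc Pc])
    then have QP: "Q * P = 0\<^sub>m (c * ?n) (c * ?n)" using Pc PP by simp
    have "Q * Q = Q * 1\<^sub>m (c * ?n) - Q * P"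
      using mult_minus_distrib_mat[OF Qc one_carrier_mat Pc] by (simp add: Q_def)
    also have "\<dots> = Q" using Qc QP by (intro eq_matI) auto
    finally have "Q * Q = Q" .
    moreover have "block ?n ?n Q p q = 0\<^sub>m ?n ?n"
      if pq: "p < c" "q < c" "\<not> (b \<le> p \<and> q < b)" for p q
    proof -
      have "block ?n ?n Q p q = block ?n ?n (1\<^sub>m (c * ?n)) p q - block ?n ?n P p q"
        using Pc pq by (intro eq_matI) (auto simp: Q_def block_index block_index_less)
      then show ?thesis using f(2)[OF pq] 2 pq by (auto simp: block_one)
    qed
    ultimately have Q0: "Q = 0\<^sub>m (c * ?n) (c * ?n)"
      using corner_nilpotent[OF Qc] by blast
    have "W' \<subseteq> {0\<^sub>v (c * ?n)}"
    proof
      fix w assume w: "w \<in> W'"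
      then have wc: "w \<in> carrier_vec (c * ?n)" using W(2) by blast
      have "w = Q *\<^sub>v w" using Qv[OF wc] P(3)[OF w] wc by simp
      also have "\<dots> = 0\<^sub>v (c * ?n)" using wc unfolding Q0 by (auto intro!: eq_vecI)
      finally show "w \<in> {0\<^sub>v (c * ?n)}" by simp
    qed
    then have "W' = {0\<^sub>v (c * ?n)}" using W(4) by blast
    then show ?thesis by simp
  qed
qed

end

lemma wild_if_almost_full:
  fixes S :: "('m::monoid_add \<Rightarrow>\<^sub>0 'k::field) \<Rightarrow> nat \<Rightarrow> nat \<Rightarrow> (bool free_monoid \<Rightarrow>\<^sub>0 'k)"
  assumes "almost_full_matrix_algebra_hom c S b"
    and "\<And>M. M \<in> fdmods \<Longrightarrow> mdim M \<noteq> 0 \<Longrightarrow> matrix_algebra_hom.induced c S M \<in> D"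
  shows "wild D"
proof -
  interpret almost_full_matrix_algebra_hom c S b by fact
  show ?thesis
    unfolding wild_def
    using exact_linear_functor_induced induced_indecomposable induced_reflects_iso assms(2)
    by blast
qed

section \<open>Linear functionals on the group algebra\<close>

text \<open>There is no case for 0, which is a single with coefficient 0.\<close>

lemma malg_induct [case_names single add]:
  fixes a :: "'m \<Rightarrow>\<^sub>0 'k::comm_monoid_add"
  assumes single: "\<And>x k. P (Poly_Mapping.single x k)" and add: "\<And>a b. P a \<Longrightarrow> P b \<Longrightarrow> P (a + b)"
  shows "P a"
proof -
  have "P (\<Sum>x\<in>A. Poly_Mapping.single x (Poly_Mapping.lookup a x))" for A
    by (induction A rule: infinite_finite_induct)
      (use single[of undefined 0] single add in auto)
  moreover have "(\<Sum>x\<in>Poly_Mapping.keys a. Poly_Mapping.single x (Poly_Mapping.lookup a x)) = a"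
    by (intro poly_mapping_eqI) (simp add: lookup_sum lookup_single when_def sum.delta' in_keys_iff)
  ultimately show ?thesis by metis
qed

lemma lookup_malg_scale: "Poly_Mapping.lookup (malg_scale k a) x = k * Poly_Mapping.lookup a x"
  by (simp add: malg_scale_def Poly_Mapping.map.rep_eq when_def flip: mult_map_scale_conv_mult)

text \<open>The linear extension of \<open>\<phi>\<close> from the monoid to its algebra. It is used
  for the constant 1, which gives the augmentation, and for additive maps, which give
  derivations.\<close>

definition functional :: "('m \<Rightarrow> 'k) \<Rightarrow> ('m \<Rightarrow>\<^sub>0 'k::field) \<Rightarrow> 'k" where
  "functional \<phi> a = (\<Sum>x\<in>Poly_Mapping.keys a. Poly_Mapping.lookup a x * \<phi> x)"

lemma functional_superset:
  assumes "finite A" "Poly_Mapping.keys a \<subseteq> A"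
  shows "functional \<phi> a = (\<Sum>x\<in>A. Poly_Mapping.lookup a x * \<phi> x)"
  unfolding functional_def using assms
  by (intro sum.mono_neutral_left) (auto simp: in_keys_iff)

lemma functional_single [simp]: "functional \<phi> (Poly_Mapping.single x k) = k * \<phi> x"
  by (simp add: functional_def)

lemma functional_add [simp]: "functional \<phi> (a + b) = functional \<phi> a + functional \<phi> b"
proof -
  let ?A = "Poly_Mapping.keys a \<union> Poly_Mapping.keys b"
  have "Poly_Mapping.keys (a + b) \<subseteq> ?A" by (rule Poly_Mapping.keys_add)
  then show ?thesis
    using functional_superset[of ?A "a + b"] functional_superset[of ?A a] functional_superset[of ?A b]
    by (simp add: lookup_add algebra_simps sum.distrib)
qed

lemma functional_zero [simp]: "functional \<phi> 0 = 0"
  by (simp add: functional_def)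

lemma functional_one [simp]: "functional \<phi> 1 = \<phi> 0"
  using functional_single[of \<phi> 0 1] by (simp del: functional_single)

lemma functional_scale [simp]: "functional \<phi> (malg_scale k a) = k * functional \<phi> a"
proof -
  have "Poly_Mapping.keys (malg_scale k a) \<subseteq> Poly_Mapping.keys a" by (auto simp: in_keys_iff lookup_malg_scale)
  then have "functional \<phi> (malg_scale k a) = (\<Sum>x\<in>Poly_Mapping.keys a. Poly_Mapping.lookup (malg_scale k a) x * \<phi> x)"
    by (intro functional_superset) auto
  then show ?thesis by (simp add: functional_def lookup_malg_scale sum_distrib_left mult.assoc)
qed

lemma functional_diff [simp]: "functional \<phi> (a - b) = functional \<phi> a - functional \<phi> b"
  using functional_add[of \<phi> "a - b" b] by (simp del: functional_add)

lemma functional_sum [simp]: "functional \<phi> (sum h A) = (\<Sum>x\<in>A. functional \<phi> (h x))"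
  by (induction A rule: infinite_finite_induct) auto

abbreviation aug :: "('m \<Rightarrow>\<^sub>0 'k::field) \<Rightarrow> 'k" where
  "aug \<equiv> functional (\<lambda>_. 1)"

lemma aug_mult:
  fixes a b :: "'m::monoid_add \<Rightarrow>\<^sub>0 'k::field"
  shows "aug (a * b) = aug a * aug b"
proof (induction a rule: malg_induct)
  case (single x k)
  show ?case by (induction b rule: malg_induct) (simp_all add: mult_single algebra_simps)
qed (simp add: algebra_simps)

text \<open>Both sides are bilinear, and on two monoid elements the rule is the additivity of
  \<open>\<phi>\<close>. So \<open>functional \<phi>\<close> is a derivation into k, on which the
  algebra acts through the augmentation.\<close>

lemma functional_derivation:
  fixes a b :: "'m::monoid_add \<Rightarrow>\<^sub>0 'k::field"
  assumes "\<And>x y. \<phi> (x + y) = \<phi> x + \<phi> y"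
  shows "functional \<phi> (a * b) = aug a * functional \<phi> b + functional \<phi> a * aug b"
proof (induction a rule: malg_induct)
  case (single x k)
  show ?case by (induction b rule: malg_induct) (simp_all add: mult_single algebra_simps assms)
qed (simp add: algebra_simps)

section \<open>Coordinates on an elementary abelian group\<close>

text \<open>Exponent vectors with entries below p map onto the group, and there are p^r of them, so
  each group element has unique exponents. Read in k, they are additive because k has characteristic
  p.\<close>

lemma elementary_abelian_coordinates:
  fixes g :: "nat \<Rightarrow> 'e::ab_group_add"
  assumes char: "CHAR('k::field) > 0" and ea: "elementary_abelian CHAR('k) r g"
  obtains \<chi> :: "nat \<Rightarrow> 'e \<Rightarrow> 'k::field" where
    "\<And>i x y. i \<in> {1..r} \<Longrightarrow> \<chi> i (x + y) = \<chi> i x + \<chi> i y"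
    "\<And>i j. i \<in> {1..r} \<Longrightarrow> j \<in> {1..r} \<Longrightarrow> \<chi> i (g j) = (if i = j then 1 else 0)"
proof -
  define p where "p = CHAR('k)"
  have p: "p > 0" using char by (simp add: p_def)
  define nm :: "nat \<Rightarrow> 'e \<Rightarrow> 'e" where "nm n x = (\<Sum>j<n. x)" for n x
  have nm_0: "nm 0 x = 0" and nm_1: "nm (Suc 0) x = x" for x by (simp_all add: nm_def)
  have nm_add: "nm (m + n) x = nm m x + nm n x" for m n x
    by (induction n) (simp_all add: nm_def algebra_simps)
  have "nm p x = 0" for x using ea by (simp add: nm_def p_def elementary_abelian_def)
  then have nm_p: "nm (p * k) x = 0" for k x
    by (induction k) (simp_all add: nm_0 nm_add)
  have nm_mod: "nm (n mod p) x = nm n x" for n x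
    using nm_add[of "p * (n div p)" "n mod p" x] by (simp add: nm_p)
  define H where "H u = (\<Sum>i\<in>{1..r}. nm (u i) (g i))" for u
  have H_add: "H (\<lambda>i. u i + v i) = H u + H v" for u v
    by (simp add: H_def nm_add sum.distrib)
  have H_surj: "\<exists>u. H u = x" for x
  proof -
    have "x \<in> group_closure (g ` {1..r})" using ea by (simp add: elementary_abelian_def)
    then show ?thesis
    proof induction
      case (base s)
      then consider "s = 0" | j where "j \<in> {1..r}" "s = g j" by auto
      then show ?case
      proof cases
        case 1
        then have "H (\<lambda>_. 0) = s" by (simp add: H_def nm_0)
        then show ?thesis by blast
      next
        case 2
        have "H (\<lambda>i. if i = j then 1 else 0) = (\<Sum>i\<in>{1..r}. if i = j then g i else 0)"
          unfolding H_def by (intro sum.cong refl) (simp add: nm_0 nm_1)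
        then have "H (\<lambda>i. if i = j then 1 else 0) = s" using 2 by simp
        then show ?thesis by blast
      qed
    next
      case (diff s t)
      then obtain u v where uv: "H u = s" "H v = t" by blast
      \<comment> \<open>Exponents are natural numbers, so \<open>- H v\<close> is represented by
        multiplying \<open>v\<close> with \<open>p - 1\<close>.\<close>
      have "H (\<lambda>i. (p - 1) * v i) + H v = H (\<lambda>i. p * v i)"
        unfolding H_add[symmetric] using p by (intro arg_cong[of _ _ H] ext) (cases p; simp)
      also have "\<dots> = 0" by (simp add: H_def nm_p)
      finally have "H (\<lambda>i. u i + (p - 1) * v i) = s - t"
        unfolding H_add uv by (simp add: eq_neg_iff_add_eq_0)
      then show ?case by blast
    qed
  qed
  define A where "A = {1..r} \<rightarrow>\<^sub>E {..<p}"
  have H_mod: "H (restrict (\<lambda>i. u i mod p) {1..r}) = H u" for u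
    by (simp add: H_def nm_mod)
  have mod_A: "restrict (\<lambda>i. u i mod p) {1..r} \<in> A" for u
    using p by (auto simp: A_def)
  have "H ` A = UNIV" using H_surj H_mod mod_A by (metis image_eqI UNIV_eq_I)
  moreover have "card A = p ^ r" by (simp add: A_def card_PiE)
  moreover have "finite A" by (auto simp: A_def intro: finite_PiE)
  \<comment> \<open>A surjection between finite sets of the same size p^r is injective.\<close>
  ultimately have inj: "inj_on H A"
    using ea by (intro eq_card_imp_inj_on) (simp_all add: elementary_abelian_def p_def)
  define \<chi> :: "nat \<Rightarrow> 'e \<Rightarrow> 'k" where "\<chi> i x = of_nat (inv_into A H x i)" for i x
  have \<chi>_H: "\<chi> i (H u) = of_nat (u i)" if "i \<in> {1..r}" for i u
  proof -
    have "inv_into A H (H u) = restrict (\<lambda>i. u i mod p) {1..r}"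
      using inv_into_f_f[OF inj mod_A, of u] unfolding H_mod .
    then have "\<chi> i (H u) = of_nat (u i mod p)" using that by (simp add: \<chi>_def)
    \<comment> \<open>Reducing an exponent modulo \<open>p\<close> cannot be seen in k, where
      \<open>p\<close> is 0.\<close>
    also have "\<dots> = of_nat (p * (u i div p) + u i mod p)"
      unfolding of_nat_add of_nat_mult by (simp add: p_def)
    finally show ?thesis by simp
  qed
  show thesis
  proof
    fix i x y assume i: "i \<in> {1..r}"
    obtain u v where "H u = x" "H v = y" using H_surj[of x] H_surj[of y] by blast
    then show "\<chi> i (x + y) = \<chi> i x + \<chi> i y"
      using \<chi>_H[OF i, of u] \<chi>_H[OF i, of v] \<chi>_H[OF i, of "\<lambda>i. u i + v i"] H_add[of u v] by simp
  next
    fix i j assume ij: "i \<in> {1..r}" "j \<in> {1..r}"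
    have "H (\<lambda>i. if i = j then 1 else 0) = (\<Sum>i\<in>{1..r}. if i = j then g i else 0)"
      unfolding H_def by (intro sum.cong refl) (simp add: nm_0 nm_1)
    then have "H (\<lambda>i. if i = j then 1 else 0) = g j" using ij by simp
    then show "\<chi> i (g j) = (if i = j then 1 else 0)" using \<chi>_H[OF ij(1), of "\<lambda>i. if i = j then 1 else 0"] by simp
  qed
qed

section \<open>Scalars, linear combinations of actions, and homomorphisms over the free
  algebra\<close>

lemma malg_scale_mult_left: "malg_scale k a * b = malg_scale k (a * b)"
  by (simp add: malg_scale_def mult.assoc)

lemma malg_scale_mult_right: "a * malg_scale k b = malg_scale k (a * b)"
proof -
  have "a * Poly_Mapping.single 0 k = Poly_Mapping.single 0 k * a"
    by (induction a rule: malg_induct) (simp_all add: mult_single algebra_simps)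
  then show ?thesis by (simp add: malg_scale_def flip: mult.assoc)
qed

lemma act_sum_scale_vec_index:
  assumes M: "M \<in> fdmods" and v: "v \<in> vecs M" and j: "j < mdim M"
  shows "(act M (\<Sum>i\<in>I. malg_scale (k i) (h i)) *\<^sub>v v) $ j = (\<Sum>i\<in>I. k i * (act M (h i) *\<^sub>v v) $ j)"
proof -
  have dims: "dim_row (act M a) = mdim M" "dim_col (act M a) = mdim M" for a
    using act_carrier[OF M, of a] by auto
  have "(act M (\<Sum>i\<in>I. malg_scale (k i) (h i)) *\<^sub>v v) $ j
      = (\<Sum>l<mdim M. \<Sum>i\<in>I. k i * (act M (h i) $$ (j, l) * v $ l))"
    using v j by (simp add: scalar_prod_def dims act_sum_index[OF M] act_scale[OF M] atLeast0LessThan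
        sum_distrib_right mult.assoc)
  also have "\<dots> = (\<Sum>i\<in>I. \<Sum>l<mdim M. k i * (act M (h i) $$ (j, l) * v $ l))"
    by (rule sum.swap)
  finally show ?thesis
    using v j by (simp add: scalar_prod_def dims atLeast0LessThan sum_distrib_left)
qed

text \<open>Words are products of letters and span the free algebra, so commuting with the two
  letters propagates by induction on the length and then by linearity.\<close>

lemma free_algebra_fdhomI:
  fixes M N :: "(bool free_monoid, 'k::field) fdmod"
  assumes M: "M \<in> fdmods" and N: "N \<in> fdmods" and f: "f \<in> carrier_mat (mdim N) (mdim M)"
    and comm: "\<And>x. f * act M (Poly_Mapping.single (Word [x]) 1) = act N (Poly_Mapping.single (Word [x]) 1) * f"
  shows "f \<in> fdhom M N"
proof -
  have word: "f * act M (Poly_Mapping.single (Word xs) 1) = act N (Poly_Mapping.single (Word xs) 1) * f" for xs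
  proof (induction xs)
    case Nil
    then show ?case using f by (simp add: act_one M N flip: zero_free_monoid_def)
  next
    case (Cons x xs)
    let ?x = "Poly_Mapping.single (Word [x]) (1 :: 'k)" and ?xs = "Poly_Mapping.single (Word xs) (1 :: 'k)"
    have split: "Poly_Mapping.single (Word (x # xs)) 1 = ?x * ?xs" by (simp add: mult_single)
    have "f * (act M ?x * act M ?xs) = act N ?x * f * act M ?xs"
      using assoc_mult_mat[OF f act_carrier[OF M] act_carrier[OF M]] comm by metis
    also have "\<dots> = act N ?x * act N ?xs * f"
      using assoc_mult_mat[OF act_carrier[OF N] f act_carrier[OF M]]
        assoc_mult_mat[OF act_carrier[OF N] act_carrier[OF N] f] Cons.IH by metis
    finally show ?case by (simp add: split act_mult M N)
  qed
  have "f * act M a = act N a * f" for a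
  proof (induction a rule: malg_induct)
    case (single w k)
    obtain xs where w: "w = Word xs" by (cases w)
    have "Poly_Mapping.single w k = malg_scale k (Poly_Mapping.single (Word xs) 1)"
      by (simp add: malg_scale_def mult_single w)
    moreover have "f * (k \<cdot>\<^sub>m act M (Poly_Mapping.single (Word xs) 1)) = k \<cdot>\<^sub>m act N (Poly_Mapping.single (Word xs) 1) * f"
      unfolding mult_smult_distrib[OF f act_carrier[OF M]] mult_smult_assoc_mat[OF act_carrier[OF N] f] word ..
    ultimately show ?case by (simp add: act_scale M N)
  next
    case (add a b)
    then show ?case
      unfolding act_add[OF M] act_add[OF N] mult_add_distrib_mat[OF f act_carrier[OF M] act_carrier[OF M]]
        add_mult_distrib_mat[OF act_carrier[OF N] act_carrier[OF N] f] by simp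
  qed
  then show ?thesis using f by (simp add: fdhom_def)
qed

section \<open>The space spanned by the generators\<close>

locale group_coordinates =
  fixes g :: "nat \<Rightarrow> 'e::ab_group_add" and r :: nat and \<chi> :: "nat \<Rightarrow> 'e \<Rightarrow> 'k::field"
  assumes \<chi>_add: "i \<in> {1..r} \<Longrightarrow> \<chi> i (x + y) = \<chi> i x + \<chi> i y"
    and \<chi>_g: "i \<in> {1..r} \<Longrightarrow> j \<in> {1..r} \<Longrightarrow> \<chi> i (g j) = (if i = j then 1 else 0)"
begin

text \<open>On the span of the generators, \<open>D i\<close> is the coordinate belonging to
  \<open>X i\<close>; on the whole group algebra it is a derivation at the augmentation.\<close>

abbreviation D :: "nat \<Rightarrow> ('e \<Rightarrow>\<^sub>0 'k) \<Rightarrow> 'k" where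
  "D i \<equiv> functional (\<chi> i)"

abbreviation X :: "nat \<Rightarrow> ('e \<Rightarrow>\<^sub>0 'k)" where
  "X \<equiv> gen g"

lemma \<chi>_zero: "i \<in> {1..r} \<Longrightarrow> \<chi> i 0 = 0"
  using \<chi>_add[of i 0 0] by (metis add_0 add_cancel_right_right)

lemma D_gen: "i \<in> {1..r} \<Longrightarrow> j \<in> {1..r} \<Longrightarrow> D i (X j) = (if i = j then 1 else 0)"
  by (simp add: gen_def \<chi>_zero \<chi>_g)

lemma aug_gen: "aug (X j) = 0"
  by (simp add: gen_def)

lemma D_sum_gen:
  assumes "I \<subseteq> {1..r}" "i \<in> I"
  shows "D i (\<Sum>j\<in>I. malg_scale (k j) (X j)) = k i"
proof -
  have "D i (\<Sum>j\<in>I. malg_scale (k j) (X j)) = (\<Sum>j\<in>I. if i = j then k j else 0)"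
    unfolding functional_sum
  proof (rule sum.cong[OF refl])
    fix j assume "j \<in> I"
    then have "i \<in> {1..r}" "j \<in> {1..r}" using assms by auto
    then show "D i (malg_scale (k j) (X j)) = (if i = j then k j else 0)" by (simp add: D_gen)
  qed
  then show ?thesis using assms finite_subset[OF assms(1)] by simp
qed

lemma VV_expand:
  assumes "u \<in> VV g r"
  shows "aug u = 0" "u = (\<Sum>i\<in>{1..r}. malg_scale (D i u) (X i))"
proof -
  have "aug u = 0 \<and> u = (\<Sum>i\<in>{1..r}. malg_scale (D i u) (X i))"
    using assms unfolding VV_def
  proof (induction rule: malg.span_induct_alt)
    case base
    then show ?case by simp
  next
    case (step k x y)
    then obtain j where j: "j \<in> {1..r}" "x = X j" by auto
    have "(\<Sum>i\<in>{1..r}. malg_scale (D i (X j)) (X i)) = (\<Sum>i\<in>{1..r}. if i = j then X i else 0)"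
      using j(1) by (intro sum.cong refl) (auto simp: D_gen)
    then have "X j = (\<Sum>i\<in>{1..r}. malg_scale (D i (X j)) (X i))" using j(1) by simp
    then have "malg_scale k (X j) = (\<Sum>i\<in>{1..r}. malg_scale (D i (malg_scale k (X j))) (X i))"
      by (metis (no_types, lifting) functional_scale malg.scale_scale malg.scale_sum_right sum.cong)
    moreover have "(\<Sum>i\<in>{1..r}. malg_scale (D i (malg_scale k x + y)) (X i))
        = (\<Sum>i\<in>{1..r}. malg_scale (D i (malg_scale k x)) (X i)) + (\<Sum>i\<in>{1..r}. malg_scale (D i y) (X i))"
      by (simp only: functional_add malg.scale_left_distrib sum.distrib)
    moreover have "aug (malg_scale k x + y) = 0" using step by (simp add: j(2) aug_gen)
    ultimately show ?case using step j(2) by metis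
  qed
  then show "aug u = 0" "u = (\<Sum>i\<in>{1..r}. malg_scale (D i u) (X i))" by blast+
qed

lemma inj_gen: "inj_on X {1..r}"
proof (rule inj_onI)
  fix i j assume "i \<in> {1..r}" "j \<in> {1..r}" "X i = X j"
  then show "i = j" using D_gen[of i i] D_gen[of i j] by (auto split: if_splits)
qed

lemma independent_gen:
  assumes "I \<subseteq> {1..r}"
  shows "malg.independent (X ` I)"
proof (rule malg.independent_if_scalars_zero)
  show "finite (X ` I)" using assms finite_subset by blast
  fix k x assume *: "(\<Sum>x\<in>X ` I. malg_scale (k x) x) = 0" "x \<in> X ` I"
  then obtain i where i: "i \<in> I" "x = X i" by blast
  have "(\<Sum>j\<in>I. malg_scale (k (X j)) (X j)) = 0"
    using * inj_on_subset[OF inj_gen assms] by (simp add: sum.reindex)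
  then show "k x = 0" using D_sum_gen[OF assms i(1), of "\<lambda>j. k (X j)"] i(2) by simp
qed

lemma span_gen_in_Gr:
  assumes "I \<subseteq> {1..r}"
  shows "malg.span (X ` I) \<in> Gr (card I) (VV g r)"
proof -
  have "malg.dim (malg.span (X ` I)) = card (X ` I)"
    using malg.dim_span_eq_card_independent[OF independent_gen[OF assms]] .
  then have "malg.dim (malg.span (X ` I)) = card I"
    using card_image[OF inj_on_subset[OF inj_gen assms]] by simp
  then show ?thesis
    using assms by (simp add: Gr_def VV_def malg.span_mono image_mono)
qed

text \<open>Dropping the coordinates 1, ..., s maps \<open>U\<close> to a space of dimension less
  than d, so some nonzero \<open>u\<close> in \<open>U\<close> has only coordinates among the first
  s.\<close>

lemma Gr_meets_coordinate_subspace: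
  assumes U: "U \<in> Gr d (VV g r)" and d: "d + s = r + 1" "1 \<le> d"
  obtains u i where "u \<in> U" "i \<in> {1..s}" "D i u \<noteq> 0" "\<And>j. j \<in> {s<..r} \<Longrightarrow> D j u = 0"
proof -
  have U: "malg.subspace U" "U \<subseteq> VV g r" "malg.dim U = d" using U by (auto simp: Gr_def)
  let ?I = "{s<..r}"
  define \<pi> where "\<pi> u = (\<Sum>j\<in>?I. malg_scale (D j u) (X j))" for u
  interpret proj: Vector_Spaces.linear malg_scale malg_scale \<pi>
    by unfold_locales
      (simp_all add: \<pi>_def malg.scale_left_distrib malg.scale_right_distrib sum.distrib malg.scale_sum_right)
  have "\<not> inj_on \<pi> U"
  proof
    assume inj: "inj_on \<pi> U"
    obtain B where B: "B \<subseteq> U" "malg.independent B" "U \<subseteq> malg.span B" "card B = d"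
      using malg.basis_exists[of U] U(3) by metis
    have "malg.span B \<subseteq> U" using B(1) U(1) by (rule malg.span_minimal)
    then have "inj_on \<pi> (malg.span B)" using inj by (rule inj_on_subset[rotated])
    then have "malg.independent (\<pi> ` B)"
      using proj.independent_injective_image B(2) by blast
    moreover have "\<pi> ` B \<subseteq> malg.span (X ` ?I)"
      unfolding \<pi>_def by (intro image_subsetI malg.span_sum malg.span_scale malg.span_base imageI)
    ultimately have "card (\<pi> ` B) \<le> card (X ` ?I)"
      using malg.independent_span_bound by (metis finite_greaterThanAtMost finite_imageI)
    \<comment> \<open>Here \<open>r - s = d - 1\<close>, one less than the size of the basis
      \<open>B\<close>.\<close>
    also have "\<dots> \<le> r - s" using card_image_le[of ?I X] by simp
    finally show False
      using card_image[OF inj_on_subset[OF inj B(1)]] B(4) d by simp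
  qed
  then obtain v w where vw: "v \<in> U" "w \<in> U" "v \<noteq> w" "\<pi> v = \<pi> w" by (auto simp: inj_on_def)
  define u where "u = v - w"
  have u: "u \<in> U" "u \<noteq> 0" using vw malg.subspace_diff[OF U(1)] by (auto simp: u_def)
  have zero: "D j u = 0" if "j \<in> ?I" for j
  proof -
    have "?I \<subseteq> {1..r}" by auto
    from D_sum_gen[OF this that] have "D j (\<pi> x) = D j x" for x by (simp add: \<pi>_def)
    then show ?thesis using vw(4) by (metis functional_diff right_minus_eq u_def)
  qed
  have "\<exists>i\<in>{1..s}. D i u \<noteq> 0"
  proof (rule ccontr)
    assume "\<not> ?thesis"
    then have "D i u = 0" if "i \<in> {1..r}" for i using zero[of i] that by (cases "i \<le> s") auto
    then have "(\<Sum>i\<in>{1..r}. malg_scale (D i u) (X i)) = 0" by (intro sum.neutral) simp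
    then have "u = 0" using VV_expand(2)[of u] u(1) U(2) by (metis subsetD)
    then show False using u(2) by simp
  qed
  then show thesis using that u(1) zero by blast
qed

end

section \<open>Modules of Loewy length two\<close>

text \<open>The zero set of one coordinate has codimension 1 in \<open>W\<close>, so it is maximal
  as soon as it is a submodule. Submodules of this kind bound the radical from above.\<close>

lemma maximal_submodule_coordinate:
  fixes M :: "('m::monoid_add, 'k::field) fdmod" and w :: "'k vec"
  assumes M: "M \<in> fdmods" and W: "fdsubmodule M W" and k: "k < mdim M"
    and K: "fdsubmodule M {w \<in> W. w $ k = 0}" and w: "w \<in> W" "w $ k \<noteq> 0"
  shows "maximal_submodule M W {w \<in> W. w $ k = 0}"
proof -
  let ?K = "{w \<in> W. w $ k = 0}"
  have "L = ?K \<or> L = W" if L: "fdsubmodule M L" "?K \<subseteq> L" "L \<subseteq> W" for L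
  proof (cases "\<exists>u\<in>L. u $ k \<noteq> 0")
    case True
    then obtain u :: "'k vec" where u: "u \<in> L" "u $ k \<noteq> 0" by blast
    have "W \<subseteq> L"
    proof
      fix v assume v: "v \<in> W"
      let ?e = "(v $ k / u $ k) \<cdot>\<^sub>v u"
      have c: "u \<in> vecs M" "v \<in> vecs M" using u(1) v L(3) fdsubmoduleD(1)[OF W] by auto
      have e: "?e \<in> L" using fdsubmodule_smult[OF M L(1) u(1)] .
      then have "v - ?e \<in> W" using L(3) v fdsubmodule_diff[OF M W] by blast
      moreover have "(v - ?e) $ k = 0" using c k u(2) by simp
      ultimately have "v - ?e \<in> L" using L(2) by blast
      then have "(v - ?e) + ?e \<in> L" using e by (rule fdsubmoduleD(3)[OF L(1)])
      moreover have "(v - ?e) + ?e = v" using c by (intro eq_vecI) auto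
      ultimately show "v \<in> L" by simp
    qed
    then show ?thesis using L(3) by blast
  next
    case False
    then show ?thesis using L by blast
  qed
  then show ?thesis using K w unfolding maximal_submodule_def by blast
qed

lemma fdsubmodule_vecs: "M \<in> fdmods \<Longrightarrow> fdsubmodule M (vecs M)"
  by (auto simp: fdsubmodule_def intro: mult_mat_vec_carrier[OF act_carrier])

lemma fdsubmodule_radical:
  assumes "fdsubmodule M W"
  shows "fdsubmodule M (radical M W)"
proof -
  have "fdsubmodule M N" if "maximal_submodule M W N" for N
    using that by (simp add: maximal_submodule_def)
  then show ?thesis
    using fdsubmoduleD[OF assms] by (auto simp: fdsubmodule_def radical_def)
qed

text \<open>For the arrows 1, ..., s of the Kronecker quiver this is the equal kernels property,
  required after evaluation at every module \<open>M\<close>. The vectors \<open>w q\<close> with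
  \<open>q < b\<close> form an element of the top, and \<open>T i p q\<close> is the entry of the
  i-th generator.\<close>

definition injective_design ::
  "nat \<Rightarrow> nat \<Rightarrow> nat \<Rightarrow> (nat \<Rightarrow> nat \<Rightarrow> nat \<Rightarrow> ('l::monoid_add \<Rightarrow>\<^sub>0 'k::field)) \<Rightarrow> bool"
where
  "injective_design c b s T \<longleftrightarrow> (\<forall>M \<in> fdmods. \<forall>\<alpha> w. (\<exists>i \<in> {1..s}. \<alpha> i \<noteq> 0) \<longrightarrow>
     (\<forall>q. w q \<in> vecs M) \<longrightarrow>
     (\<forall>p<c. \<forall>j<mdim M. (\<Sum>q<b. \<Sum>i\<in>{1..s}. \<alpha> i * (act M (T i p q) *\<^sub>v w q) $ j) = 0) \<longrightarrow>
     (\<forall>q<b. w q = 0\<^sub>v (mdim M)))"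

text \<open>The equations say that the matrix with blocks \<open>\<Phi> p q\<close> commutes with
  every generator. Working with the family of blocks lets a design be checked without assembling
  large matrices.\<close>

definition full_design ::
  "nat \<Rightarrow> nat \<Rightarrow> nat \<Rightarrow> (nat \<Rightarrow> nat \<Rightarrow> nat \<Rightarrow> ('l::monoid_add \<Rightarrow>\<^sub>0 'k::field)) \<Rightarrow> bool"
where
  "full_design c b r T \<longleftrightarrow> (\<forall>M \<in> fdmods. \<forall>N \<in> fdmods. \<forall>\<Phi>.
     (\<forall>p q. \<Phi> p q \<in> carrier_mat (mdim N) (mdim M)) \<longrightarrow>
     (\<forall>i \<in> {1..r}. \<forall>p<c. \<forall>q<c. \<forall>j<mdim N. \<forall>l<mdim M.
        (\<Sum>t<c. (\<Phi> p t * act M (T i t q)) $$ (j, l)) = (\<Sum>t<c. (act N (T i p t) * \<Phi> t q) $$ (j, l))) \<longrightarrow>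
     (\<exists>f \<in> fdhom M N. \<forall>p<c. \<forall>q<c. \<not> (b \<le> p \<and> q < b) \<longrightarrow>
        \<Phi> p q = (if p = q then f else 0\<^sub>m (mdim N) (mdim M))))"

text \<open>The copies with index below \<open>b\<close> form the top, the others the part of the
  socle that receives the arrows. By \<open>T_kernel\<close> the last copy of the top,
  \<open>b - 1\<close>, is killed by all generators beyond the s-th.\<close>

locale kronecker_design = group_coordinates g r \<chi>
  for g :: "nat \<Rightarrow> 'e::ab_group_add" and r :: nat and \<chi> :: "nat \<Rightarrow> 'e \<Rightarrow> 'k::field" +
  fixes c b s :: nat and T :: "nat \<Rightarrow> nat \<Rightarrow> nat \<Rightarrow> ('l::monoid_add \<Rightarrow>\<^sub>0 'k)"
  assumes b_pos: "0 < b" and b_le: "b \<le> c" and s: "1 \<le> s" "s \<le> r"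
    and T_zero: "\<not> (b \<le> p \<and> q < b) \<Longrightarrow> T i p q = 0"
    and T_inj: "injective_design c b s T"
    and T_kernel: "i \<in> {s<..r} \<Longrightarrow> T i p (b - 1) = 0"
    and T_full: "full_design c b r T"
begin

definition nil_part :: "('e \<Rightarrow>\<^sub>0 'k) \<Rightarrow> nat \<Rightarrow> nat \<Rightarrow> ('l \<Rightarrow>\<^sub>0 'k)" where
  "nil_part a p q = (\<Sum>i\<in>{1..r}. malg_scale (D i a) (T i p q))"

text \<open>The unital homomorphism that sends the i-th generator to \<open>T i\<close>. It factors
  through the quotient by the square of the augmentation ideal, since products of two of the
  matrices \<open>T i\<close> vanish.\<close>

definition S :: "('e \<Rightarrow>\<^sub>0 'k) \<Rightarrow> nat \<Rightarrow> nat \<Rightarrow> ('l \<Rightarrow>\<^sub>0 'k)" where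
  "S a p q = malg_scale (aug a) (if p = q then 1 else 0) + nil_part a p q"

lemma nil_part_zero: "\<not> (b \<le> p \<and> q < b) \<Longrightarrow> nil_part a p q = 0"
  by (simp add: nil_part_def T_zero)

lemma nil_part_mult:
  "nil_part (x * y) p q = malg_scale (aug x) (nil_part y p q) + malg_scale (aug y) (nil_part x p q)"
proof -
  have "D i (x * y) = aug x * D i y + aug y * D i x" if "i \<in> {1..r}" for i
    using functional_derivation[of "\<chi> i" x y] \<chi>_add[OF that] by (simp add: mult.commute)
  then have "nil_part (x * y) p q
      = (\<Sum>i\<in>{1..r}. malg_scale (aug x * D i y) (T i p q) + malg_scale (aug y * D i x) (T i p q))"
    unfolding nil_part_def by (intro sum.cong refl) (simp add: malg.scale_left_distrib)
  then show ?thesis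
    by (simp add: nil_part_def sum.distrib malg.scale_sum_right)
qed

sublocale matrix_algebra_hom c S
proof
  fix p q
  have "D i 1 = 0" if "i \<in> {1..r}" for i using \<chi>_zero[OF that] by simp
  then have "nil_part 1 p q = 0" unfolding nil_part_def by (intro sum.neutral) simp
  then show "S 1 p q = (if p = q then 1 else 0)" by (simp add: S_def)
  fix x y :: "'e \<Rightarrow>\<^sub>0 'k"
  show "S (x + y) p q = S x p q + S y p q"
    by (simp add: S_def nil_part_def malg.scale_left_distrib sum.distrib)
  show "S (malg_scale k x) p q = malg_scale k (S x p q)" for k
    by (simp add: S_def nil_part_def malg.scale_right_distrib malg.scale_sum_right)
  assume pq: "p < c" "q < c"
  have "S x p t * S y t q = (if t = p then malg_scale (aug x) (S y p q) else 0)
      + (if t = q then malg_scale (aug y) (nil_part x p q) else 0)" for t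
  proof -
    \<comment> \<open>The first factor vanishes unless \<open>t < b\<close>, the second unless
      \<open>b \<le> t\<close>.\<close>
    have "nil_part x p t * nil_part y t q = 0"
      by (cases "t < b") (simp_all add: nil_part_zero)
    then show ?thesis
      by (simp add: S_def distrib_left distrib_right malg_scale_mult_left malg_scale_mult_right
          malg.scale_right_distrib)
  qed
  then have "(\<Sum>t<c. S x p t * S y t q)
      = malg_scale (aug x) (S y p q) + malg_scale (aug y) (nil_part x p q)"
    using pq by (simp add: sum.distrib)
  also have "\<dots> = S (x * y) p q"
    by (simp add: S_def nil_part_mult aug_mult malg.scale_right_distrib add.assoc)
  finally show "S (x * y) p q = (\<Sum>t<c. S x p t * S y t q)" ..
qed

lemma S_gen: "i \<in> {1..r} \<Longrightarrow> S (X i) p q = T i p q"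
proof -
  assume i: "i \<in> {1..r}"
  have "nil_part (X i) p q = (\<Sum>j\<in>{1..r}. if j = i then T i p q else 0)"
    unfolding nil_part_def using i by (intro sum.cong refl) (simp add: D_gen)
  then show ?thesis using i by (simp add: S_def aug_gen)
qed

sublocale almost_full_matrix_algebra_hom c S b
proof
  fix M N \<Phi> assume M: "M \<in> fdmods" and N: "N \<in> fdmods" and \<Phi>: "\<Phi> \<in> fdhom (induced M) (induced N)"
  have \<Phi>c: "\<Phi> \<in> carrier_mat (c * mdim N) (c * mdim M)" using fdhomD(1)[OF \<Phi>] by simp
  have "(\<Sum>t<c. (block (mdim N) (mdim M) \<Phi> p t * act M (T i t q)) $$ (j, l))
      = (\<Sum>t<c. (act N (T i p t) * block (mdim N) (mdim M) \<Phi> t q) $$ (j, l))"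
    if *: "i \<in> {1..r}" "p < c" "q < c" "j < mdim N" "l < mdim M" for i p q j l
  proof -
    have "(\<Sum>t<c. (block (mdim N) (mdim M) \<Phi> p t * act M (T i t q)) $$ (j, l))
        = block (mdim N) (mdim M) (\<Phi> * act (induced M) (X i)) p q $$ (j, l)"
      using * block_mult_index[OF \<Phi>c act_induced_carrier *(2-5)]
      by (simp add: block_act_induced[OF M] S_gen)
    also have "\<dots> = block (mdim N) (mdim M) (act (induced N) (X i) * \<Phi>) p q $$ (j, l)"
      by (simp add: fdhomD(2)[OF \<Phi>])
    also have "\<dots> = (\<Sum>t<c. (act N (T i p t) * block (mdim N) (mdim M) \<Phi> t q) $$ (j, l))"
      using * block_mult_index[OF act_induced_carrier \<Phi>c *(2-5)]
      by (simp add: block_act_induced[OF N] S_gen)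
    finally show ?thesis .
  qed
  then show "\<exists>f\<in>fdhom M N. \<forall>p<c. \<forall>q<c. \<not> (b \<le> p \<and> q < b) \<longrightarrow>
      block (mdim N) (mdim M) \<Phi> p q = (if p = q then f else 0\<^sub>m (mdim N) (mdim M))"
    using T_full[unfolded full_design_def, rule_format, OF M N, of "block (mdim N) (mdim M) \<Phi>"]
    by simp
qed (fact b_pos b_le)+

text \<open>The copies of \<open>M\<close> outside the top. This subspace contains the radical, and
  it turns out to be \<open>Soc U\<close> for every d-dimensional \<open>U\<close>.\<close>

definition lower :: "('l, 'k) fdmod \<Rightarrow> 'k vec set" where
  "lower M = {v \<in> vecs (induced M). \<forall>q<b. vblock (mdim M) v q = 0\<^sub>v (mdim M)}"

section \<open>Radical series and socles of a single induced module\<close>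

context
  fixes M :: "('l, 'k) fdmod"
  assumes M: "M \<in> fdmods"
begin

lemma vblock_act_index:
  assumes "v \<in> carrier_vec (c * mdim M)" "p < c" "j < mdim M"
  shows "vblock (mdim M) (act (induced M) a *\<^sub>v v) p $ j
    = aug a * vblock (mdim M) v p $ j
      + (\<Sum>t<b. \<Sum>i\<in>{1..r}. D i a * (act M (T i p t) *\<^sub>v vblock (mdim M) v t) $ j)"
proof -
  let ?n = "mdim M" and ?v = "vblock (mdim M) v"
  have carr: "act M x *\<^sub>v ?v t \<in> carrier_vec ?n" for x t
    by (rule mult_mat_vec_carrier[OF act_carrier[OF M] vblock_carrier])
  have split: "(act M (S a p t) *\<^sub>v ?v t) $ j = (if p = t then aug a * ?v p $ j else 0)
      + (\<Sum>i\<in>{1..r}. D i a * (act M (T i p t) *\<^sub>v ?v t) $ j)" for t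
  proof -
    have "act M (S a p t) *\<^sub>v ?v t
        = act M (malg_scale (aug a) (if p = t then 1 else 0)) *\<^sub>v ?v t + act M (nil_part a p t) *\<^sub>v ?v t"
      unfolding S_def act_add[OF M]
      by (rule add_mult_distrib_mat_vec[OF act_carrier[OF M] act_carrier[OF M] vblock_carrier])
    moreover have "(act M (malg_scale (aug a) (if p = t then 1 else 0)) *\<^sub>v ?v t) $ j
        = (if p = t then aug a * ?v p $ j else 0)"
      using assms(3) by (simp add: act_scale[OF M] act_one[OF M] act_zero[OF M] scalar_prod_left_unit)
    moreover have "(act M (nil_part a p t) *\<^sub>v ?v t) $ j
        = (\<Sum>i\<in>{1..r}. D i a * (act M (T i p t) *\<^sub>v ?v t) $ j)"
      unfolding nil_part_def by (rule act_sum_scale_vec_index[OF M vblock_carrier assms(3)])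
    ultimately show ?thesis using assms(3) carrier_vecD[OF carr] by simp
  qed
  have T0: "(act M (T i p t) *\<^sub>v ?v t) $ j = 0" if "b \<le> t" for i t
    using that assms(3) by (simp add: T_zero act_zero[OF M])
  have "vblock ?n (act (induced M) a *\<^sub>v v) p $ j = (\<Sum>t<c. (act M (S a p t) *\<^sub>v ?v t) $ j)"
    using vblock_mult_index[OF act_induced_carrier assms, of a]
    by (simp add: block_act_induced[OF M assms(2)])
  also have "\<dots> = aug a * ?v p $ j
      + (\<Sum>t<c. \<Sum>i\<in>{1..r}. D i a * (act M (T i p t) *\<^sub>v ?v t) $ j)"
    using assms(2) by (simp add: split sum.distrib)
  also have "(\<Sum>t<c. \<Sum>i\<in>{1..r}. D i a * (act M (T i p t) *\<^sub>v ?v t) $ j)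
      = (\<Sum>t<b. \<Sum>i\<in>{1..r}. D i a * (act M (T i p t) *\<^sub>v ?v t) $ j)"
    using b_le by (intro sum.mono_neutral_right) (auto simp: T0 intro!: sum.neutral)
  finally show ?thesis .
qed

text \<open>All generators start in the top, so on \<open>lower M\<close> only the augmentation
  remains, and every subspace of \<open>lower M\<close> is a submodule.\<close>

lemma act_lower:
  assumes "v \<in> lower M"
  shows "act (induced M) a *\<^sub>v v = aug a \<cdot>\<^sub>v v"
proof (rule vblock_eqI[where c = c and n = "mdim M"])
  have v: "v \<in> carrier_vec (c * mdim M)" using assms by (simp add: lower_def)
  show "act (induced M) a *\<^sub>v v \<in> carrier_vec (c * mdim M)"
    by (rule mult_mat_vec_carrier[OF act_induced_carrier v])
  show "aug a \<cdot>\<^sub>v v \<in> carrier_vec (c * mdim M)" using v by simp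
  fix p assume p: "p < c"
  show "vblock (mdim M) (act (induced M) a *\<^sub>v v) p = vblock (mdim M) (aug a \<cdot>\<^sub>v v) p"
  proof (rule eq_vecI)
    fix j assume "j < dim_vec (vblock (mdim M) (aug a \<cdot>\<^sub>v v) p)"
    then have j: "j < mdim M" by simp
    have "(act M x *\<^sub>v vblock (mdim M) v t) $ j = 0" if "t < b" for t x
      using assms that j act_carrier[OF M, of x] by (simp add: lower_def)
    then show "vblock (mdim M) (act (induced M) a *\<^sub>v v) p $ j = vblock (mdim M) (aug a \<cdot>\<^sub>v v) p $ j"
      using vblock_act_index[OF v p j, of a] v p j
      by (simp add: vblock_index block_index_less)
  qed simp
qed

text \<open>No generator ends in the top. Hence the zero set of a coordinate of the top is a
  submodule, although the top itself need not be one.\<close>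

lemma act_top_coordinate:
  assumes "v \<in> carrier_vec (c * mdim M)" "q < b" "j < mdim M"
  shows "(act (induced M) a *\<^sub>v v) $ (q * mdim M + j) = aug a * v $ (q * mdim M + j)"
proof -
  have "q < c" using assms(2) b_le by simp
  have "(act M (T i q t) *\<^sub>v vblock (mdim M) v t) $ j = 0" for i t
    using assms(2,3) by (simp add: T_zero act_zero[OF M])
  then show ?thesis
    using vblock_act_index[OF assms(1) \<open>q < c\<close> assms(3), of a] assms(3) by (simp add: vblock_index)
qed

text \<open>The zero sets of the coordinates of the top are maximal submodules (or everything), and
  \<open>lower M\<close> is their intersection.\<close>

lemma radical_induced_subset: "radical (induced M) (vecs (induced M)) \<subseteq> lower M"
proof
  fix v assume v: "v \<in> radical (induced M) (vecs (induced M))"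
  then have vc: "v \<in> carrier_vec (c * mdim M)" by (simp add: radical_def)
  have "v $ (q * mdim M + j) = 0" if qj: "q < b" "j < mdim M" for q j
  proof (rule ccontr)
    let ?k = "q * mdim M + j"
    assume nz: "v $ ?k \<noteq> 0"
    have k: "?k < c * mdim M" using qj b_le by (simp add: block_index_less)
    have "fdsubmodule (induced M) {w \<in> vecs (induced M). w $ ?k = 0}"
      using k act_top_coordinate[OF _ qj] mult_mat_vec_carrier[OF act_induced_carrier]
      by (auto simp: fdsubmodule_def)
    then have "maximal_submodule (induced M) (vecs (induced M)) {w \<in> vecs (induced M). w $ ?k = 0}"
      using maximal_submodule_coordinate[OF induced_fdmods[OF M] fdsubmodule_vecs[OF induced_fdmods[OF M]]]
        k nz vc by simp
    then show False using v nz by (auto simp: radical_def)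
  qed
  then show "v \<in> lower M"
    using vc by (auto simp: lower_def vblock_index intro!: eq_vecI)
qed

text \<open>The algebra acts on \<open>W\<close> by scalars, so now the zero set of every coordinate
  is a submodule, and these intersect in 0.\<close>

lemma radical_of_lower:
  assumes W: "fdsubmodule (induced M) W" "W \<subseteq> lower M"
  shows "radical (induced M) W = {0\<^sub>v (c * mdim M)}"
proof (intro equalityI subsetI)
  fix v assume v: "v \<in> radical (induced M) W"
  then have vW: "v \<in> W" by (simp add: radical_def)
  then have vc: "v \<in> carrier_vec (c * mdim M)" using fdsubmoduleD(1)[OF W(1)] by auto
  have "v $ k = 0" if k: "k < c * mdim M" for k
  proof (rule ccontr)
    assume nz: "v $ k \<noteq> 0"
    have "fdsubmodule (induced M) {w \<in> W. w $ k = 0}"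
      unfolding fdsubmodule_def
    proof (intro conjI ballI allI)
      show "{w \<in> W. w $ k = 0} \<subseteq> vecs (induced M)" "0\<^sub>v (mdim (induced M)) \<in> {w \<in> W. w $ k = 0}"
        using fdsubmoduleD[OF W(1)] k by auto
      fix w assume w: "w \<in> {w \<in> W. w $ k = 0}"
      then have wc: "w \<in> carrier_vec (c * mdim M)" using fdsubmoduleD(1)[OF W(1)] by auto
      show "w' + w \<in> {w \<in> W. w $ k = 0}" if "w' \<in> {w \<in> W. w $ k = 0}" for w'
        using that w wc k fdsubmoduleD(3)[OF W(1)] by auto
      show "act (induced M) a *\<^sub>v w \<in> {w \<in> W. w $ k = 0}" for a
        using w wc k fdsubmoduleD(4)[OF W(1), of w a] act_lower[of w a] W(2) by auto
    qed
    then have "maximal_submodule (induced M) W {w \<in> W. w $ k = 0}"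
      using maximal_submodule_coordinate[OF induced_fdmods[OF M] W(1)] k nz vW by simp
    then show False using v nz by (auto simp: radical_def)
  qed
  then have "v = 0\<^sub>v (c * mdim M)" using vc by (intro eq_vecI) auto
  then show "v \<in> {0\<^sub>v (c * mdim M)}" by simp
next
  fix v :: "'k vec"
  assume "v \<in> {0\<^sub>v (c * mdim M)}"
  then show "v \<in> radical (induced M) W"
    using fdsubmoduleD(2)[OF fdsubmodule_radical[OF W(1)]] by simp
qed

lemma loewy_length_induced: "loewy_length (induced M) \<le> 2"
proof -
  have "radical (induced M) (radical (induced M) (vecs (induced M))) = {0\<^sub>v (c * mdim M)}"
    by (rule radical_of_lower[OF fdsubmodule_radical[OF fdsubmodule_vecs[OF induced_fdmods[OF M]]]
          radical_induced_subset])
  then show ?thesis unfolding loewy_length_def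
    by (intro Least_le) (simp add: numeral_2_eq_2)
qed

text \<open>Such a \<open>u\<close> acts as a nonzero combination of the first s generators, which
  \<open>T_inj\<close> makes injective on the top.\<close>

lemma lower_if_killed:
  assumes v: "v \<in> carrier_vec (c * mdim M)" and u: "aug u = 0" "i \<in> {1..s}" "D i u \<noteq> 0"
    "\<And>j. j \<in> {s<..r} \<Longrightarrow> D j u = 0" and killed: "act (induced M) u *\<^sub>v v = 0\<^sub>v (c * mdim M)"
  shows "v \<in> lower M"
proof -
  have "(\<Sum>t<b. \<Sum>i\<in>{1..s}. D i u * (act M (T i p t) *\<^sub>v vblock (mdim M) v t) $ j) = 0"
    if pj: "p < c" "j < mdim M" for p j
  proof -
    have "0 = vblock (mdim M) (act (induced M) u *\<^sub>v v) p $ j"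
      using pj by (simp add: killed vblock_index block_index_less)
    also have "\<dots> = (\<Sum>t<b. \<Sum>i\<in>{1..r}. D i u * (act M (T i p t) *\<^sub>v vblock (mdim M) v t) $ j)"
      using vblock_act_index[OF v pj, of u] u(1) by simp
    also have "\<dots> = (\<Sum>t<b. \<Sum>i\<in>{1..s}. D i u * (act M (T i p t) *\<^sub>v vblock (mdim M) v t) $ j)"
      using s u(4) by (intro sum.cong refl sum.mono_neutral_right) auto
    finally show ?thesis ..
  qed
  moreover have "\<exists>i\<in>{1..s}. D i u \<noteq> 0" using u(2,3) by blast
  ultimately have "\<forall>q<b. vblock (mdim M) v q = 0\<^sub>v (mdim M)"
    using T_inj[unfolded injective_design_def, rule_format, OF M, of "\<lambda>i. D i u" "vblock (mdim M) v"]
    by simp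
  then show ?thesis using v by (simp add: lower_def)
qed

text \<open>One inclusion needs a single element of \<open>U\<close>, the one without coordinates
  beyond s; for the other, elements of \<open>U\<close> have augmentation 0 and so kill
  \<open>lower M\<close>.\<close>

lemma Soc_induced:
  assumes "d + s = r + 1" "U \<in> Gr d (VV g r)"
  shows "Soc U (induced M) = lower M"
proof (intro equalityI subsetI)
  have UV: "U \<subseteq> VV g r" using assms(2) by (simp add: Gr_def)
  {
    fix v assume v: "v \<in> Soc U (induced M)"
    obtain u i where u: "u \<in> U" "i \<in> {1..s}" "D i u \<noteq> 0" "\<And>j. j \<in> {s<..r} \<Longrightarrow> D j u = 0"
      using Gr_meets_coordinate_subspace[OF assms(2,1)] assms(1) s(2) by auto
    show "v \<in> lower M"
      using lower_if_killed[OF _ _ u(2-4)] v u(1) UV VV_expand(1) by (auto simp: Soc_def)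
  }
  fix v assume v: "v \<in> lower M"
  then have vc: "v \<in> carrier_vec (c * mdim M)" by (simp add: lower_def)
  have "act (induced M) u *\<^sub>v v = 0\<^sub>v (c * mdim M)" if "u \<in> U" for u
  proof -
    have "aug u = 0" using VV_expand(1) that UV by blast
    then have "act (induced M) u *\<^sub>v v = 0 \<cdot>\<^sub>v v" using act_lower[OF v, of u] by simp
    also have "\<dots> = 0\<^sub>v (c * mdim M)" using vc by (intro eq_vecI) auto
    finally show ?thesis .
  qed
  then show "v \<in> Soc U (induced M)" using vc by (simp add: Soc_def)
qed

lemma equal_Soc_induced: "d + s = r + 1 \<Longrightarrow> equal_Soc g r d (induced M)"
  by (simp add: equal_Soc_def Soc_induced)

text \<open>Two coordinate subspaces of dimension d - 1 are compared: one is spanned by the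
  generators beyond the s-th, which kill a vector of the top, the other contains the first
  generator, which kills none but 0.\<close>

lemma not_equal_Soc_induced:
  assumes d: "d + s = r + 1" "2 \<le> d" and nz: "mdim M \<noteq> 0"
  shows "\<not> equal_Soc g r (d - 1) (induced M)"
proof
  assume eq: "equal_Soc g r (d - 1) (induced M)"
  let ?n = "mdim M" and ?F = "act (induced M)"
  \<comment> \<open>A nonzero vector in the copy \<open>b - 1\<close>, the one that
    \<open>T_kernel\<close> speaks of.\<close>
  define v :: "'k vec" where "v = block_vec ?n c (\<lambda>q. if q = b - 1 then unit_vec ?n 0 else 0\<^sub>v ?n)"
  have v: "v \<in> carrier_vec (c * ?n)" by (simp add: v_def)
  have vb: "vblock ?n v q = (if q = b - 1 then unit_vec ?n 0 else 0\<^sub>v ?n)" if "q < c" for q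
    using that by (simp add: v_def vblock_block_vec)
  let ?U = "malg.span (X ` {s<..r})" and ?U' = "malg.span (X ` {1..d - 1})"
  have I: "{s<..r} \<subseteq> {1..r}" "card {s<..r} = d - 1" "{1..d - 1} \<subseteq> {1..r}" "card {1..d - 1} = d - 1"
    using d s by auto
  have "?U \<in> Gr (d - 1) (VV g r)"
    using span_gen_in_Gr[OF I(1)] unfolding I(2) .
  moreover have "?U' \<in> Gr (d - 1) (VV g r)"
    using span_gen_in_Gr[OF I(3)] unfolding I(4) .
  ultimately have eq: "Soc ?U (induced M) = Soc ?U' (induced M)"
    using eq unfolding equal_Soc_def by blast
  have killed_gen: "?F (X i) *\<^sub>v v = 0\<^sub>v (c * ?n)" if i: "i \<in> {s<..r}" for i
  proof (rule vblock_eqI[where c = c and n = ?n])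
    show "?F (X i) *\<^sub>v v \<in> carrier_vec (c * ?n)" by (rule mult_mat_vec_carrier[OF act_induced_carrier v])
    fix p assume p: "p < c"
    show "vblock ?n (?F (X i) *\<^sub>v v) p = vblock ?n (0\<^sub>v (c * ?n)) p"
    proof (rule eq_vecI)
      fix j assume "j < dim_vec (vblock ?n (0\<^sub>v (c * ?n)) p)"
      then have j: "j < ?n" by simp
      have "D l (X i) * (act M (T l p t) *\<^sub>v vblock ?n v t) $ j = 0" if lt: "l \<in> {1..r}" "t < b" for l t
      proof (cases "l = i \<and> t = b - 1")
        case True
        then show ?thesis using T_kernel[OF i, of p] j by (simp add: act_zero[OF M])
      next
        case False
        have "t < c" using lt b_le by simp
        then show ?thesis
          using False vb[of t] D_gen[of l i] lt i j act_carrier[OF M, of "T l p t"] by auto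
      qed
      then have "(\<Sum>t<b. \<Sum>l\<in>{1..r}. D l (X i) * (act M (T l p t) *\<^sub>v vblock ?n v t) $ j) = 0"
        by (intro sum.neutral ballI) auto
      then show "vblock ?n (?F (X i) *\<^sub>v v) p $ j = vblock ?n (0\<^sub>v (c * ?n)) p $ j"
        using vblock_act_index[OF v p j, of "X i"] j p
        by (simp add: aug_gen vblock_index block_index_less)
    qed simp
  qed simp
  have "?F u *\<^sub>v v = 0\<^sub>v (c * ?n)" if "u \<in> ?U" for u
    using that
  proof (induction rule: malg.span_induct_alt)
    case base
    then show ?case using v by (auto simp: act_zero[OF induced_fdmods[OF M]] intro!: eq_vecI)
  next
    case (step k x y)
    then obtain i where i: "i \<in> {s<..r}" "x = X i" by auto
    have "?F (malg_scale k x + y) *\<^sub>v v = k \<cdot>\<^sub>m ?F x *\<^sub>v v + ?F y *\<^sub>v v"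
      unfolding act_add[OF induced_fdmods[OF M]] act_scale[OF induced_fdmods[OF M]]
      by (rule add_mult_distrib_mat_vec[OF _ act_induced_carrier v])
        (rule smult_carrier_mat[OF act_induced_carrier])
    also have "k \<cdot>\<^sub>m ?F x *\<^sub>v v = k \<cdot>\<^sub>v (?F x *\<^sub>v v)"
      using carrier_matD[OF act_induced_carrier[of M x]] v
      by (intro eq_vecI) (auto simp: scalar_prod_def sum_distrib_left mult.assoc)
    finally show ?case using step killed_gen[OF i(1)] i(2) by (auto intro!: eq_vecI)
  qed
  then have "v \<in> Soc ?U (induced M)" using v by (simp add: Soc_def)
  \<comment> \<open>This is where \<open>2 \<le> d\<close> enters: for \<open>d = 1\<close> the span
    would be 0.\<close>
  moreover have "X 1 \<in> ?U'" using d by (intro malg.span_base imageI) auto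
  ultimately have killed: "?F (X 1) *\<^sub>v v = 0\<^sub>v (c * ?n)"
    unfolding eq by (simp add: Soc_def)
  have "D j (X 1) = (if j = 1 then 1 else 0)" if "j \<in> {1..r}" for j
    using D_gen[of j 1] that s by auto
  then have "v \<in> lower M"
    using s by (intro lower_if_killed[OF v _ _ _ _ killed, of 1]) (auto simp: aug_gen)
  then have "vblock ?n v (b - 1) = 0\<^sub>v ?n" using b_pos by (simp add: lower_def)
  moreover have "vblock ?n v (b - 1) = unit_vec ?n 0" using vb[of "b - 1"] b_pos b_le by simp
  ultimately show False using nz by (metis neq0_conv unit_vec_nonzero)
qed

lemma induced_mem_ESP2:
  assumes d: "d + s = r + 1" and nz: "mdim M \<noteq> 0"
  shows "induced M \<in> ESP2 g r d - ESP2 g r (d - 1)"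
proof -
  have "1 \<le> d" using d s by simp
  then have "induced M \<in> ESP2 g r d"
    using induced_fdmods[OF M] loewy_length_induced equal_Soc_induced[OF d] by (simp add: ESP2_def)
  moreover have "induced M \<notin> ESP2 g r (d - 1)"
  \<comment> \<open>For \<open>d = 1\<close> the subtracted class is empty by convention.\<close>
  proof (cases "d = 1")
    case False
    then have "2 \<le> d" using \<open>1 \<le> d\<close> by simp
    then show ?thesis using not_equal_Soc_induced[OF d _ nz] by (simp add: ESP2_def)
  qed (simp add: ESP2_def)
  ultimately show ?thesis by blast
qed

end

end

lemma wild_if_kronecker_design:
  fixes T :: "nat \<Rightarrow> nat \<Rightarrow> nat \<Rightarrow> (bool free_monoid \<Rightarrow>\<^sub>0 'k::field)"
    and g :: "nat \<Rightarrow> 'e::ab_group_add"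
  assumes "kronecker_design g r \<chi> c b s T" and d: "d + s = r + 1"
  shows "wild (ESP2 g r d - ESP2 g r (d - 1) :: ('e, 'k) fdmod set)"
proof -
  interpret kronecker_design g r \<chi> c b s T by fact
  show ?thesis
    by (rule wild_if_almost_full[OF almost_full_matrix_algebra_hom_axioms]) (rule induced_mem_ESP2[OF _ d])
qed

section \<open>The two families of Kronecker modules\<close>

abbreviation letter :: "bool \<Rightarrow> (bool free_monoid \<Rightarrow>\<^sub>0 'k::field)" where
  "letter x \<equiv> Poly_Mapping.single (Word [x]) 1"

lemma act_vec_index_simps:
  assumes "M \<in> fdmods" "v \<in> vecs M" "j < mdim M"
  shows "(act M 0 *\<^sub>v v) $ j = 0" "(act M 1 *\<^sub>v v) $ j = v $ j"
  using assms by (simp_all add: act_zero act_one)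

lemma act_mat_index_simps:
  fixes \<Phi> :: "nat \<Rightarrow> nat \<Rightarrow> 'k::field mat"
  assumes M: "M \<in> fdmods" and N: "N \<in> fdmods"
    and \<Phi>: "\<forall>p q. \<Phi> p q \<in> carrier_mat (mdim N) (mdim M)"
    and jl: "j < mdim N" "l < mdim M"
  shows "(\<Phi> p q * act M 0) $$ (j, l) = 0"
    and "(\<Phi> p q * act M 1) $$ (j, l) = \<Phi> p q $$ (j, l)"
    and "(\<Phi> p q * act M (malg_scale k 1)) $$ (j, l) = k * \<Phi> p q $$ (j, l)"
    and "(act N 0 * \<Phi> p q) $$ (j, l) = 0"
    and "(act N 1 * \<Phi> p q) $$ (j, l) = \<Phi> p q $$ (j, l)"
    and "(act N (malg_scale k 1) * \<Phi> p q) $$ (j, l) = k * \<Phi> p q $$ (j, l)"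
    and "(0\<^sub>m (mdim N) (mdim M) * act M a) $$ (j, l) = 0"
    and "(act N a * 0\<^sub>m (mdim N) (mdim M)) $$ (j, l) = 0"
proof -
  note z = act_zero[OF M] act_zero[OF N] act_one[OF M] act_one[OF N] act_scale[OF M] act_scale[OF N]
  have \<Phi>c: "\<Phi> p q \<in> carrier_mat (mdim N) (mdim M)" using \<Phi> by blast
  note p = \<Phi>c jl
  show "(\<Phi> p q * act M 0) $$ (j, l) = 0" "(act N 0 * \<Phi> p q) $$ (j, l) = 0"
    "(\<Phi> p q * act M 1) $$ (j, l) = \<Phi> p q $$ (j, l)"
    "(act N 1 * \<Phi> p q) $$ (j, l) = \<Phi> p q $$ (j, l)"
    using p by (simp_all add: z)
  show "(\<Phi> p q * act M (malg_scale k 1)) $$ (j, l) = k * \<Phi> p q $$ (j, l)"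
    using p mult_smult_distrib[OF \<Phi>c one_carrier_mat, of k] by (simp add: z)
  show "(act N (malg_scale k 1) * \<Phi> p q) $$ (j, l) = k * \<Phi> p q $$ (j, l)"
    using p mult_smult_assoc_mat[OF one_carrier_mat \<Phi>c, of k] by (simp add: z)
  show "(0\<^sub>m (mdim N) (mdim M) * act M a) $$ (j, l) = 0"
    "(act N a * 0\<^sub>m (mdim N) (mdim M)) $$ (j, l) = 0"
    using jl carrier_matD[OF act_carrier[OF M, of a]] carrier_matD[OF act_carrier[OF N, of a]]
    by (simp_all add: scalar_prod_def)
qed

subsection \<open>Two generators acting freely\<close>

text \<open>
  The first three generators map \<open>N\<^sup>3\<close> to \<open>N\<^sup>3 \<oplus> N\<^sup>3\<close> by \<open>(1, 0)\<close>, \<open>(0, 1)\<close> and \<open>(L, Q)\<close>, where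
  \<open>L = diag(1, \<mu>, 0)\<close> and the strictly lower triangular part of \<open>Q\<close> glues the three copies of \<open>N\<close>.
  A homomorphism commutes with \<open>L\<close>, hence is block diagonal, and with \<open>Q\<close>, hence its diagonal blocks
  agree and commute with both letters. The last copy of \<open>N\<close> is killed by \<open>L\<close> and \<open>Q\<close>.
\<close>

definition eigen_design :: "'k::field \<Rightarrow> nat \<Rightarrow> nat \<Rightarrow> nat \<Rightarrow> (bool free_monoid \<Rightarrow>\<^sub>0 'k)" where
  "eigen_design \<mu> i p q =
    (if i \<in> {1, 2} \<and> q < 3 \<and> p = 3 * i + q then 1
     else if i = 3 \<and> (p, q) \<in> {(3, 0), (7, 0), (8, 1)} then 1
     else if i = 3 \<and> (p, q) = (4, 1) then malg_scale \<mu> 1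
     else if i = 3 \<and> (p, q) = (6, 0) then letter False
     else if i = 3 \<and> (p, q) = (8, 0) then letter True
     else 0)"

lemma eigen_design_free:
  assumes "i \<in> {1, 2}"
  shows "eigen_design \<mu> i p q = (if q < 3 \<and> p = 3 * i + q then 1 else 0)"
proof -
  have "i \<noteq> 3" using assms by auto
  then show ?thesis using assms by (simp add: eigen_design_def)
qed

text \<open>The index of a socle copy encodes a pair: \<open>p div 3\<close> is the free generator
  that reaches it, \<open>p mod 3\<close> the copy of the top it comes from.\<close>

lemma div_mod_3_eq_iff: "t < 3 \<and> p = 3 * i + t \<longleftrightarrow> t = p mod 3 \<and> p div 3 = i" for t p i :: nat
  by auto

lemma lessThan_9: "{..<9} = {0, 1, 2, 3, 4, 5, 6, 7, 8 :: nat}"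
  by (simp add: eval_nat_numeral lessThan_Suc insert_commute)

lemma eigen_design_3:
  "eigen_design \<mu> 3 p 0 = (if p \<in> {3, 7} then 1 else if p = 6 then letter False
     else if p = 8 then letter True else 0)"
  "eigen_design \<mu> 3 p (Suc 0) = (if p = 4 then malg_scale \<mu> 1 else if p = 8 then 1 else 0)"
  "q \<noteq> 0 \<Longrightarrow> q \<noteq> Suc 0 \<Longrightarrow> eigen_design \<mu> 3 p q = 0"
  by (simp_all add: eigen_design_def)

lemma eigen_design_sum_left:
  fixes M N :: "(bool free_monoid, 'k::field) fdmod" and \<Phi> :: "nat \<Rightarrow> nat \<Rightarrow> 'k mat"
  assumes M: "M \<in> fdmods" and N: "N \<in> fdmods"
    and \<Phi>: "\<forall>p q. \<Phi> p q \<in> carrier_mat (mdim N) (mdim M)"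
    and jl: "j < mdim N" "l < mdim M"
  shows "(\<Sum>t<9. (\<Phi> p t * act M (eigen_design \<mu> 3 t 0)) $$ (j, l)) =
      \<Phi> p 3 $$ (j, l) + (\<Phi> p 6 * act M (letter False)) $$ (j, l) + \<Phi> p 7 $$ (j, l)
      + (\<Phi> p 8 * act M (letter True)) $$ (j, l)"
    and "(\<Sum>t<9. (\<Phi> p t * act M (eigen_design \<mu> 3 t 1)) $$ (j, l)) =
      \<mu> * \<Phi> p 4 $$ (j, l) + \<Phi> p 8 $$ (j, l)"
    and "(\<Sum>t<9. (\<Phi> p t * act M (eigen_design \<mu> 3 t 2)) $$ (j, l)) = 0"
  by (simp_all add: lessThan_9 eigen_design_3 act_mat_index_simps[OF M N \<Phi> jl])

lemma eigen_design_sum_right: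
  fixes M N :: "(bool free_monoid, 'k::field) fdmod" and \<Phi> :: "nat \<Rightarrow> nat \<Rightarrow> 'k mat"
  assumes M: "M \<in> fdmods" and N: "N \<in> fdmods"
    and \<Phi>: "\<forall>p q. \<Phi> p q \<in> carrier_mat (mdim N) (mdim M)"
    and jl: "j < mdim N" "l < mdim M"
  shows "(\<Sum>t<9. (act N (eigen_design \<mu> 3 p t) * \<Phi> t q) $$ (j, l)) =
    (if p \<in> {3, 7} then \<Phi> 0 q $$ (j, l) else if p = 4 then \<mu> * \<Phi> 1 q $$ (j, l)
     else if p = 6 then (act N (letter False) * \<Phi> 0 q) $$ (j, l)
     else if p = 8 then (act N (letter True) * \<Phi> 0 q) $$ (j, l) + \<Phi> 1 q $$ (j, l) else 0)"
  by (simp add: lessThan_9 eigen_design_3 act_mat_index_simps[OF M N \<Phi> jl])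
text \<open>If \<open>\<alpha> i\<close> is nonzero, row \<open>3 * i + q\<close> of the combination
  has \<open>\<alpha> i\<close> in column \<open>q\<close> as its only nonzero entry, which forces
  \<open>w q = 0\<close>.\<close>

lemma injective_eigen_design:
  fixes \<mu> :: "'k::field"
  shows "injective_design 9 3 2 (eigen_design \<mu>)"
proof -
  let ?T = "eigen_design \<mu>"
  show ?thesis
    unfolding injective_design_def
  proof (intro ballI allI impI)
    fix M :: "(bool free_monoid, 'k) fdmod" and \<alpha> :: "nat \<Rightarrow> 'k" and w :: "nat \<Rightarrow> 'k vec" and q :: nat
    assume M: "M \<in> fdmods" and "\<exists>i\<in>{1..2}. \<alpha> i \<noteq> 0" and w: "\<forall>q. w q \<in> vecs M"
      and eq: "\<forall>p<9. \<forall>j<mdim M.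
        (\<Sum>q<3. \<Sum>i\<in>{1..2}. \<alpha> i * (act M (?T i p q) *\<^sub>v w q) $ j) = 0"
      and q: "q < 3"
    then obtain i where i: "i \<in> {1..2}" "\<alpha> i \<noteq> 0" by blast
    have "w q $ j = 0" if j: "j < mdim M" for j
    proof -
      have "\<alpha> i' * (act M (?T i' (3 * i + q) q') *\<^sub>v w q') $ j = (if i' = i \<and> q' = q then \<alpha> i * w q $ j else 0)"
        if "i' \<in> {1..2}" "q' < 3" for i' q'
      proof -
        have "?T i' (3 * i + q) q' = (if i' = i \<and> q' = q then 1 else 0)"
        proof -
          have "i' \<in> {1, 2}" using that(1) by auto
          moreover have "q' < 3 \<and> 3 * i + q = 3 * i' + q' \<longleftrightarrow> i' = i \<and> q' = q"
            using div_mod_3_eq_iff[of q' "3 * i + q" i'] q by auto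
          ultimately show ?thesis by (simp add: eigen_design_free)
        qed
        then show ?thesis using j w by (simp add: act_vec_index_simps[OF M])
      qed
      then have "(\<Sum>q'<3. \<Sum>i'\<in>{1..2}. \<alpha> i' * (act M (?T i' (3 * i + q) q') *\<^sub>v w q') $ j)
          = (\<Sum>q'<3. \<Sum>i'\<in>{1..2}. if i' = i \<and> q' = q then \<alpha> i * w q $ j else 0)"
        by (intro sum.cong refl) auto
      also have "\<dots> = (\<Sum>q'<3. if q' = q then \<alpha> i * w q $ j else 0)"
        using i(1) by (intro sum.cong refl) (auto simp: sum.delta)
      also have "\<dots> = \<alpha> i * w q $ j" using q by simp
      finally show ?thesis using eq[rule_format, of "3 * i + q" j] i q j by auto
    qed
    then show "w q = 0\<^sub>v (mdim M)" using w[rule_format, of q] by (intro eq_vecI) auto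
  qed
qed

text \<open>Let A be the block of \<open>\<Phi>\<close> on the top. Commuting with the first two
  generators makes \<open>\<Phi>\<close> act on both halves of the socle as A and kills its blocks
  from socle to top. Commuting with the third then says A L = L A in rows 3 to 5 and A Q = Q A in
  rows 6 to 8.\<close>

lemma eigen_design_hom:
  fixes M N :: "(bool free_monoid, 'k::field) fdmod" and \<Phi> :: "nat \<Rightarrow> nat \<Rightarrow> 'k mat"
  assumes M: "M \<in> fdmods" and N: "N \<in> fdmods" and r: "r \<ge> 3" and \<mu>: "\<mu> \<noteq> 0" "\<mu> \<noteq> 1"
    and \<Phi>: "\<forall>p q. \<Phi> p q \<in> carrier_mat (mdim N) (mdim M)"
    and eq: "\<forall>i\<in>{1..r}. \<forall>p<9. \<forall>q<9. \<forall>j<mdim N. \<forall>l<mdim M.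
      (\<Sum>t<9. (\<Phi> p t * act M (eigen_design \<mu> i t q)) $$ (j, l))
      = (\<Sum>t<9. (act N (eigen_design \<mu> i p t) * \<Phi> t q) $$ (j, l))"
  shows "\<Phi> 0 0 \<in> fdhom M N"
    and "\<And>p q. p < 9 \<Longrightarrow> q < 9 \<Longrightarrow> \<not> (3 \<le> p \<and> q < 3) \<Longrightarrow>
      \<Phi> p q = (if p = q then \<Phi> 0 0 else 0\<^sub>m (mdim N) (mdim M))"
proof -
  let ?T = "eigen_design \<mu>"
  let ?m = "mdim N" and ?n = "mdim M"
  let ?O = "0\<^sub>m ?m ?n :: 'k mat"
  note simps = act_mat_index_simps[OF M N \<Phi>]
  have \<Phi>c: "\<Phi> p q \<in> carrier_mat ?m ?n" for p q using \<Phi> by blast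
  have \<Phi>_eqI: "\<Phi> p q = A" if "A \<in> carrier_mat ?m ?n"
    "\<And>j l. j < ?m \<Longrightarrow> l < ?n \<Longrightarrow> \<Phi> p q $$ (j, l) = A $$ (j, l)" for p q A
    using that \<Phi>c[of p q] by (intro eq_matI) auto
  have \<Phi>_index: "\<Phi> p (3 * i + q) $$ (j, l) = (if p div 3 = i then \<Phi> (p mod 3) q $$ (j, l) else 0)"
    if i: "i \<in> {1, 2}" and pq: "p < 9" "q < 3" and jl: "j < ?m" "l < ?n" for i p q j l
  proof -
    have T1: "?T i t q = (if t = 3 * i + q then 1 else 0)" for t
      using pq(2) by (simp add: eigen_design_free[OF i])
    have T2: "?T i p t = (if t = p mod 3 \<and> p div 3 = i then 1 else 0)" for t
      by (simp add: eigen_design_free[OF i] div_mod_3_eq_iff)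
    have "(\<Sum>t<9. (\<Phi> p t * act M (?T i t q)) $$ (j, l))
        = (\<Sum>t<9. if t = 3 * i + q then \<Phi> p (3 * i + q) $$ (j, l) else 0)"
      using jl by (intro sum.cong refl) (simp add: T1 simps)
    moreover have "(\<Sum>t<9. (act N (?T i p t) * \<Phi> t q) $$ (j, l))
        = (\<Sum>t<9. if t = p mod 3 then if p div 3 = i then \<Phi> (p mod 3) q $$ (j, l) else 0 else 0)"
      using jl by (intro sum.cong refl) (auto simp: T2 simps)
    moreover have "3 * i + q < 9" "p mod 3 < 9" using i pq by auto
    ultimately show ?thesis
      using eq[rule_format, of i p q j l] i pq jl r by auto
  qed
  have \<Phi>_eq: "\<Phi> p (3 * i + q) = (if p div 3 = i then \<Phi> (p mod 3) q else ?O)"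
    if "i \<in> {1, 2}" "p < 9" "q < 3" for i p q
    by (rule \<Phi>_eqI) (auto simp: \<Phi>_index[OF that] \<Phi>c)
  have cols: "\<Phi> p 3 $$ (j, l) = (if p div 3 = 1 then \<Phi> (p mod 3) 0 $$ (j, l) else 0)"
    "\<Phi> p 4 $$ (j, l) = (if p div 3 = 1 then \<Phi> (p mod 3) 1 $$ (j, l) else 0)"
    "\<Phi> p 6 = (if p div 3 = 2 then \<Phi> (p mod 3) 0 else ?O)"
    "\<Phi> p 7 $$ (j, l) = (if p div 3 = 2 then \<Phi> (p mod 3) 1 $$ (j, l) else 0)"
    "\<Phi> p 8 = (if p div 3 = 2 then \<Phi> (p mod 3) 2 else ?O)"
    if "p < 9" "j < ?m" "l < ?n" for p j l :: nat
    using \<Phi>_index[of 1 p 0 j l] \<Phi>_index[of 1 p 1 j l] \<Phi>_eq[of 2 p 0] \<Phi>_index[of 2 p 1 j l] \<Phi>_eq[of 2 p 2] that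
    by simp_all
  have eq3: "(\<Sum>t<9. (\<Phi> p t * act M (?T 3 t q)) $$ (j, l)) = (\<Sum>t<9. (act N (?T 3 p t) * \<Phi> t q) $$ (j, l))"
    if "p < 9" "q < 3" "j < ?m" "l < ?n" for p q j l
    using eq[rule_format, of 3 p q j l] r that by auto
  note sums = eigen_design_sum_left[OF M N \<Phi>] eigen_design_sum_right[OF M N \<Phi>]
  have col0: "(if p div 3 = 1 then \<Phi> (p mod 3) 0 $$ (j, l) else 0)
      + ((if p div 3 = 2 then \<Phi> (p mod 3) 0 else ?O) * act M (letter False)) $$ (j, l)
      + (if p div 3 = 2 then \<Phi> (p mod 3) 1 $$ (j, l) else 0)
      + ((if p div 3 = 2 then \<Phi> (p mod 3) 2 else ?O) * act M (letter True)) $$ (j, l)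
      = (if p \<in> {3, 7} then \<Phi> 0 0 $$ (j, l) else if p = 4 then \<mu> * \<Phi> 1 0 $$ (j, l)
     else if p = 6 then (act N (letter False) * \<Phi> 0 0) $$ (j, l)
     else if p = 8 then (act N (letter True) * \<Phi> 0 0) $$ (j, l) + \<Phi> 1 0 $$ (j, l) else 0)"
    if "p < 9" "j < ?m" "l < ?n" for p j l :: nat
    using eq3[of p 0 j l] that unfolding sums[OF that(2,3)] cols[OF that] by simp
  have col1: "\<mu> * (if p div 3 = 1 then \<Phi> (p mod 3) 1 $$ (j, l) else 0)
      + (if p div 3 = 2 then \<Phi> (p mod 3) 2 else ?O) $$ (j, l)
      = (if p \<in> {3, 7} then \<Phi> 0 1 $$ (j, l) else if p = 4 then \<mu> * \<Phi> 1 1 $$ (j, l)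
     else if p = 6 then (act N (letter False) * \<Phi> 0 1) $$ (j, l)
     else if p = 8 then (act N (letter True) * \<Phi> 0 1) $$ (j, l) + \<Phi> 1 1 $$ (j, l) else 0)"
    if "p < 9" "j < ?m" "l < ?n" for p j l :: nat
    using eq3[of p 1 j l] that unfolding sums[OF that(2,3)] cols[OF that] by simp
  have col2: "0 = (if p \<in> {3, 7} then \<Phi> 0 2 $$ (j, l) else if p = 4 then \<mu> * \<Phi> 1 2 $$ (j, l)
     else if p = 6 then (act N (letter False) * \<Phi> 0 2) $$ (j, l)
     else if p = 8 then (act N (letter True) * \<Phi> 0 2) $$ (j, l) + \<Phi> 1 2 $$ (j, l) else 0)"
    if "p < 9" "j < ?m" "l < ?n" for p j l :: nat
    using eq3[of p 2 j l] that unfolding sums[OF that(2,3)] by simp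
  \<comment> \<open>An off-diagonal block of A is multiplied by the difference of two of the
    eigenvalues 1, \<open>\<mu>\<close>, 0 of L.\<close>
  have z02: "\<Phi> 0 2 = ?O"
    using col2[of 3] by (intro \<Phi>_eqI) auto
  have z12: "\<Phi> 1 2 = ?O"
    using col2[of 4] \<mu> by (intro \<Phi>_eqI) auto
  have z01: "\<Phi> 0 1 = ?O"
    using col1[of 3] \<mu> by (intro \<Phi>_eqI) auto
  have z21: "\<Phi> 2 1 = ?O"
    using col1[of 5] \<mu> by (intro \<Phi>_eqI) auto
  have z10: "\<Phi> 1 0 = ?O"
  proof (rule \<Phi>_eqI)
    fix j l assume "j < ?m" "l < ?n"
    then have "\<Phi> 1 0 $$ (j, l) = \<mu> * \<Phi> 1 0 $$ (j, l)"
      using col0[of 4 j l] by (simp add: simps)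
    then show "\<Phi> 1 0 $$ (j, l) = ?O $$ (j, l)" using \<mu> \<open>j < ?m\<close> \<open>l < ?n\<close> by simp
  qed simp
  have z20: "\<Phi> 2 0 = ?O"
    using col0[of 5] by (intro \<Phi>_eqI) (auto simp: simps)
  note zeros = z02 z12[unfolded One_nat_def] z01[unfolded One_nat_def] z21[unfolded One_nat_def]
    z10[unfolded One_nat_def] z20
  \<comment> \<open>The entries 1 of Q at (1, 0) and (2, 1) identify consecutive diagonal blocks of
    A.\<close>
  have d1: "\<Phi> 1 1 = \<Phi> 0 0"
    using col0[of 7] by (intro \<Phi>_eqI \<Phi>c) (auto simp: simps zeros)
  have d2: "\<Phi> 2 2 = \<Phi> 1 1"
    using col1[of 8] by (intro \<Phi>_eqI \<Phi>c) (auto simp: simps zeros)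
  \<comment> \<open>The letters are the entries of Q at (0, 0) and (2, 0).\<close>
  have comm_False: "\<Phi> 0 0 * act M (letter False) = act N (letter False) * \<Phi> 0 0"
  proof (rule eq_matI)
    fix j l assume "j < dim_row (act N (letter False) * \<Phi> 0 0)" "l < dim_col (act N (letter False) * \<Phi> 0 0)"
    then have "j < ?m" "l < ?n"
      using carrier_matD[OF act_carrier[OF N]] carrier_matD[OF \<Phi>c] by auto
    then show "(\<Phi> 0 0 * act M (letter False)) $$ (j, l) = (act N (letter False) * \<Phi> 0 0) $$ (j, l)"
      using col0[of 6 j l] by (simp add: simps zeros del: index_mult_mat)
  qed (use carrier_matD[OF act_carrier[OF M]] carrier_matD[OF act_carrier[OF N]] carrier_matD[OF \<Phi>c] in auto)
  have comm_True: "\<Phi> 0 0 * act M (letter True) = act N (letter True) * \<Phi> 0 0"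
  proof (rule eq_matI)
    fix j l assume "j < dim_row (act N (letter True) * \<Phi> 0 0)" "l < dim_col (act N (letter True) * \<Phi> 0 0)"
    then have "j < ?m" "l < ?n"
      using carrier_matD[OF act_carrier[OF N]] carrier_matD[OF \<Phi>c] by auto
    then show "(\<Phi> 0 0 * act M (letter True)) $$ (j, l) = (act N (letter True) * \<Phi> 0 0) $$ (j, l)"
      using col0[of 8 j l] d1 d2 by (simp add: simps zeros del: index_mult_mat)
  qed (use carrier_matD[OF act_carrier[OF M]] carrier_matD[OF act_carrier[OF N]] carrier_matD[OF \<Phi>c] in auto)
  have "\<Phi> 0 0 * act M (letter x) = act N (letter x) * \<Phi> 0 0" for x
    using comm_True comm_False by (cases x) auto
  then show "\<Phi> 0 0 \<in> fdhom M N"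
    by (intro free_algebra_fdhomI[OF M N \<Phi>c])
  show "\<Phi> p q = (if p = q then \<Phi> 0 0 else ?O)" if "p < 9" "q < 9" "\<not> (3 \<le> p \<and> q < 3)" for p q
  proof -
    have diag: "\<Phi> p' q' = (if p' = q' then \<Phi> 0 0 else ?O)" if "p' < 3" "q' < 3" for p' q'
    proof -
      have "p' = 0 \<or> p' = 1 \<or> p' = 2" "q' = 0 \<or> q' = 1 \<or> q' = 2" using that by auto
      then show ?thesis using d1 d2 z02 z12 z01 z21 z10 z20 by auto
    qed
    show ?thesis
    proof (cases "q < 3")
      case True
      then show ?thesis using diag that by simp
    next
      case False
      then have "q div 3 \<in> {1, 2}" using that(2) by auto
      then have "\<Phi> p q = (if p div 3 = q div 3 then \<Phi> (p mod 3) (q mod 3) else ?O)"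
        using \<Phi>_eq[of "q div 3" p "q mod 3"] that(1) by simp
      moreover have "p = q \<longleftrightarrow> p div 3 = q div 3 \<and> p mod 3 = q mod 3" by (metis div_mult_mod_eq)
      ultimately show ?thesis using diag[of "p mod 3" "q mod 3"] by auto
    qed
  qed
qed

lemma full_eigen_design:
  assumes "r \<ge> 3" "\<mu> \<noteq> 0" "\<mu> \<noteq> 1"
  shows "full_design 9 3 r (eigen_design \<mu>)"
  unfolding full_design_def
proof (intro ballI allI impI, goal_cases)
  case (1 M N \<Phi>)
  note hom = eigen_design_hom[OF 1(1,2) assms 1(3,4)]
  show ?case by (rule bexI[OF _ hom(1)]) (intro allI impI hom(2))
qed

lemma eigen_design_zero: "(3 \<le> p \<and> q < 3) \<or> eigen_design \<mu> i p q = 0"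
  by (auto simp: eigen_design_def)

lemma eigen_design_kernel: "i \<in> {1, 2} \<or> eigen_design \<mu> i p 2 = 0"
  by (auto simp: eigen_design_def)

lemma kronecker_eigen_design:
  assumes "group_coordinates g r \<chi>" "r \<ge> 3" "\<mu> \<noteq> 0" "\<mu> \<noteq> 1"
  shows "kronecker_design g r \<chi> 9 3 2 (eigen_design \<mu>)"
proof (rule kronecker_design.intro[OF assms(1)], rule kronecker_design_axioms.intro, goal_cases)
  case (5 p q i)
  then show ?case using eigen_design_zero[of p q \<mu> i] by blast
next
  case (7 i p)
  then show ?case using eigen_design_kernel[of i \<mu> p] by simp
qed (use assms(2) injective_eigen_design full_eigen_design[OF assms(2-4)] in simp_all)

subsection \<open>At least three generators acting freely\<close>

text \<open>
  Here the generators \<open>1, \<dots>, s\<close> map \<open>N\<^sup>2\<close> to the quotient of \<open>k\<^sup>s \<otimes> N\<^sup>2\<close> by the copy of \<open>N\<close> formed by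
  the elements \<open>e\<^sub>s \<otimes> (0, n) - e\<^sub>1 \<otimes> (n, 0) - e\<^sub>2 \<otimes> (X n, Y n)\<close>, with \<open>e\<^sub>s \<otimes> (0, n)\<close> eliminated, where
  \<open>X\<close>, \<open>Y\<close> denote the two letters. As none of these elements is a pure tensor, every nonzero linear
  combination of the generators acts injectively.
\<close>

definition quotient_design :: "nat \<Rightarrow> nat \<Rightarrow> nat \<Rightarrow> nat \<Rightarrow> (bool free_monoid \<Rightarrow>\<^sub>0 'k::field)" where
  "quotient_design s i p q =
    (if i \<in> {1..s} \<and> q < 2 \<and> p = 2 * i + q \<and> (i, q) \<noteq> (s, 1) then 1
     else if i = s \<and> q = 1 \<and> p = 2 then 1
     else if i = s \<and> q = 1 \<and> p = 4 then letter True
     else if i = s \<and> q = 1 \<and> p = 5 then letter False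
     else 0)"

lemma quotient_design_free:
  assumes "s \<ge> 3" "i \<in> {1..s}" "q < 2" "(i, q) \<noteq> (s, 1)"
  shows "quotient_design s i p q = (if p = 2 * i + q then 1 else 0)"
  using assms by (auto simp: quotient_design_def)

lemma quotient_design_last:
  assumes "s \<ge> 3"
  shows "quotient_design s s p 1 =
    (if p = 2 then 1 else if p = 4 then letter True else if p = 5 then letter False else 0)"
  by (simp add: quotient_design_def)

lemma quotient_design_zero:
  assumes "s \<ge> 3" "\<not> (2 \<le> p \<and> q < 2)"
  shows "quotient_design s i p q = 0"
  using assms by (auto simp: quotient_design_def)

text \<open>Socle copies are numbered \<open>2 * i + q\<close>; the eliminated pair (s, 1) would
  have number \<open>2 * s + 1\<close>, just outside the range.\<close>

lemma quotient_design_index_cases: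
  fixes s t :: nat
  assumes "2 \<le> t" "t < 2 * s + 1"
  obtains i q where "i \<in> {1..s}" "q < 2" "(i, q) \<noteq> (s, 1)" "t = 2 * i + q"
proof
  show "t div 2 \<in> {1..s}" "t mod 2 < 2" "t = 2 * (t div 2) + t mod 2" using assms by auto
  show "(t div 2, t mod 2) \<noteq> (s, 1)"
  proof
    assume "(t div 2, t mod 2) = (s, 1)"
    then have "t = 2 * s + 1" using mult_div_mod_eq[of 2 t] by simp
    then show False using assms by simp
  qed
qed

lemma sum_lessThan_2: "(\<Sum>q<2. h q) = h 0 + h (1 :: nat)"
  by (simp add: numeral_2_eq_2)

text \<open>If \<open>\<alpha> s\<close> is nonzero, row \<open>2 * s\<close> sees only
  \<open>w 0\<close>, and once that vanishes row 2 sees only \<open>w 1\<close>. Otherwise the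
  relation does not intervene, and rows \<open>2 * i0\<close> and \<open>2 * i0 + 1\<close> isolate
  the two vectors for any \<open>i0\<close> with \<open>\<alpha> i0\<close> nonzero.\<close>

lemma injective_quotient_design:
  assumes s: "s \<ge> 3"
  shows "injective_design (2 * s + 1) 2 s (quotient_design s :: _ \<Rightarrow> _ \<Rightarrow> _ \<Rightarrow> (_ \<Rightarrow>\<^sub>0 'k::field))"
  unfolding injective_design_def
proof (intro ballI allI impI, goal_cases)
  case (1 M \<alpha> w q)
  let ?T = "quotient_design s :: _ \<Rightarrow> _ \<Rightarrow> _ \<Rightarrow> (_ \<Rightarrow>\<^sub>0 'k)"
  note M = 1(1)
  have w: "w q \<in> vecs M" for q using 1(3) by blast
  note vec_simps = act_vec_index_simps[OF M w]
  have row: "(\<Sum>i\<in>{1..s}. \<alpha> i * (act M (?T i p 0) *\<^sub>v w 0) $ j)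
      + (\<Sum>i\<in>{1..s}. \<alpha> i * (act M (?T i p 1) *\<^sub>v w 1) $ j) = 0"
    if "p < 2 * s + 1" "j < mdim M" for p j
    using 1(4)[rule_format, OF that] by (simp only: sum_lessThan_2)
  have delta: "(\<Sum>i\<in>{1..s}. \<alpha> i * (act M (?T i p q) *\<^sub>v w q) $ j) = \<alpha> i0 * w q $ j"
    if "i0 \<in> {1..s}" "j < mdim M" "\<And>i. i \<in> {1..s} \<Longrightarrow> \<alpha> i \<noteq> 0 \<Longrightarrow> ?T i p q = (if i = i0 then 1 else 0)" for p q i0 j
  proof -
    have "(\<Sum>i\<in>{1..s}. \<alpha> i * (act M (?T i p q) *\<^sub>v w q) $ j) = (\<Sum>i\<in>{1..s}. if i = i0 then \<alpha> i0 * w q $ j else 0)"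
    proof (rule sum.cong[OF refl])
      fix i assume "i \<in> {1..s}"
      then show "\<alpha> i * (act M (?T i p q) *\<^sub>v w q) $ j = (if i = i0 then \<alpha> i0 * w q $ j else 0)"
        using that(3)[of i] that(2) by (cases "\<alpha> i = 0") (auto simp: vec_simps)
    qed
    then show ?thesis using that(1) by simp
  qed
  have null: "(\<Sum>i\<in>{1..s}. \<alpha> i * (act M (?T i p q) *\<^sub>v w q) $ j) = 0"
    if "j < mdim M" "\<And>i. i \<in> {1..s} \<Longrightarrow> \<alpha> i \<noteq> 0 \<Longrightarrow> ?T i p q = 0" for p q j
  proof (rule sum.neutral, rule ballI)
    fix i assume "i \<in> {1..s}"
    then show "\<alpha> i * (act M (?T i p q) *\<^sub>v w q) $ j = 0"
      using that(2)[of i] that(1) by (cases "\<alpha> i = 0") (simp_all add: vec_simps)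
  qed
  have "\<forall>j<mdim M. w 0 $ j = 0 \<and> w 1 $ j = 0"
  proof (cases "\<alpha> s = 0")
    case False
    have w0: "w 0 $ j = 0" if j: "j < mdim M" for j
    proof -
      have "(\<Sum>i\<in>{1..s}. \<alpha> i * (act M (?T i (2 * s) 0) *\<^sub>v w 0) $ j) = \<alpha> s * w 0 $ j"
        using s j by (intro delta) (auto simp: quotient_design_free)
      moreover have "(\<Sum>i\<in>{1..s}. \<alpha> i * (act M (?T i (2 * s) 1) *\<^sub>v w 1) $ j) = 0"
      proof (rule null[OF j])
        have "2 * s \<noteq> 2 * i + 1" for i by presburger
        then show "?T i (2 * s) 1 = 0" for i using s by (simp add: quotient_design_def)
      qed
      ultimately show ?thesis using row[of "2 * s" j] j False by simp
    qed
    then have "w 0 = 0\<^sub>v (mdim M)" using w[of 0] by (intro eq_vecI) auto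
    then have zero: "(act M a *\<^sub>v w 0) $ j = 0" if "j < mdim M" for a j
      using that carrier_matD[OF act_carrier[OF M, of a]] by (simp add: scalar_prod_def)
    have "w 1 $ j = 0" if j: "j < mdim M" for j
    proof -
      have "(\<Sum>i\<in>{1..s}. \<alpha> i * (act M (?T i 2 1) *\<^sub>v w 1) $ j) = \<alpha> s * w 1 $ j"
      proof (rule delta[OF _ j])
        have "2 \<noteq> 2 * i + (1::nat)" for i by presburger
        then show "?T i 2 1 = (if i = s then 1 else 0)" for i using s by (simp add: quotient_design_def)
      qed (use s in simp)
      then show ?thesis using row[of 2 j] s j False by (simp add: zero)
    qed
    with w0 show ?thesis by blast
  next
    case True
    obtain i0 where i0: "i0 \<in> {1..s}" "\<alpha> i0 \<noteq> 0" using 1(2) by blast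
    then have "i0 \<noteq> s" using True by auto
    have T: "?T i (2 * i0 + q) q' = (if i = i0 \<and> q' = q then 1 else 0)"
      if "i \<in> {1..s}" "\<alpha> i \<noteq> 0" "q < 2" "q' < 2" for i q q'
    proof -
      have "i \<noteq> s" using that(2) True by auto
      then have "?T i (2 * i0 + q) q' = (if 2 * i0 + q = 2 * i + q' then 1 else 0)"
        by (intro quotient_design_free[OF s that(1,4)]) simp
      moreover have "2 * i0 + q = 2 * i + q' \<longleftrightarrow> i = i0 \<and> q' = q" using that(3,4) by presburger
      ultimately show ?thesis by simp
    qed
    have less: "2 * i0 + q < 2 * s + 1" if "q < 2" for q using that i0 \<open>i0 \<noteq> s\<close> by auto
    have "w 0 $ j = 0 \<and> w 1 $ j = 0" if j: "j < mdim M" for j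
    proof
      have "(\<Sum>i\<in>{1..s}. \<alpha> i * (act M (?T i (2 * i0 + 0) 0) *\<^sub>v w 0) $ j) = \<alpha> i0 * w 0 $ j"
        by (rule delta[OF i0(1) j]) (use T[of _ 0 0] in simp)
      moreover have "(\<Sum>i\<in>{1..s}. \<alpha> i * (act M (?T i (2 * i0 + 0) 1) *\<^sub>v w 1) $ j) = 0"
        by (rule null[OF j]) (use T[of _ 0 1] in simp)
      ultimately show "w 0 $ j = 0" using row[OF less[of 0] j] i0(2) by simp
      have "(\<Sum>i\<in>{1..s}. \<alpha> i * (act M (?T i (2 * i0 + 1) 1) *\<^sub>v w 1) $ j) = \<alpha> i0 * w 1 $ j"
        by (rule delta[OF i0(1) j]) (use T[of _ 1 1] in simp)
      moreover have "(\<Sum>i\<in>{1..s}. \<alpha> i * (act M (?T i (2 * i0 + 1) 0) *\<^sub>v w 0) $ j) = 0"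
        by (rule null[OF j]) (use T[of _ 1 0] in simp)
      ultimately show "w 1 $ j = 0" using row[OF less[of 1] j] i0(2) by simp
    qed
    then show ?thesis by blast
  qed
  moreover have "q = 0 \<or> q = 1" using 1(5) by auto
  ultimately show ?case using w[of q] by (intro eq_vecI) auto
qed

text \<open>Let A be the block of \<open>\<Phi>\<close> on the top. The free entries of the
  generators express all further columns of \<open>\<Phi>\<close> through A; the remaining column,
  that of generator s on copy 1, says that \<open>\<Phi>\<close> respects the relation, and this is
  what restricts A.\<close>

lemma quotient_design_hom:
  fixes M N :: "(bool free_monoid, 'k::field) fdmod" and \<Phi> :: "nat \<Rightarrow> nat \<Rightarrow> 'k mat"
  assumes M: "M \<in> fdmods" and N: "N \<in> fdmods" and s: "s \<ge> 3" "s \<le> r"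
    and \<Phi>: "\<forall>p q. \<Phi> p q \<in> carrier_mat (mdim N) (mdim M)"
    and eq: "\<forall>i\<in>{1..r}. \<forall>p<2 * s + 1. \<forall>q<2 * s + 1. \<forall>j<mdim N. \<forall>l<mdim M.
      (\<Sum>t<2 * s + 1. (\<Phi> p t * act M (quotient_design s i t q)) $$ (j, l))
      = (\<Sum>t<2 * s + 1. (act N (quotient_design s i p t) * \<Phi> t q) $$ (j, l))"
  shows "\<Phi> 0 0 \<in> fdhom M N"
    and "\<And>p q. p < 2 * s + 1 \<Longrightarrow> q < 2 * s + 1 \<Longrightarrow> \<not> (2 \<le> p \<and> q < 2) \<Longrightarrow>
      \<Phi> p q = (if p = q then \<Phi> 0 0 else 0\<^sub>m (mdim N) (mdim M))"
proof -
  let ?c = "2 * s + 1" and ?m = "mdim N" and ?n = "mdim M"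
  let ?T = "quotient_design s :: _ \<Rightarrow> _ \<Rightarrow> _ \<Rightarrow> (bool free_monoid \<Rightarrow>\<^sub>0 'k)"
  let ?O = "0\<^sub>m ?m ?n :: 'k mat"
  note simps = act_mat_index_simps[OF M N \<Phi>]
  have \<Phi>c: "\<Phi> p q \<in> carrier_mat ?m ?n" for p q using \<Phi> by blast
  have \<Phi>_eqI: "\<Phi> p q = A" if "A \<in> carrier_mat ?m ?n"
    "\<And>j l. j < ?m \<Longrightarrow> l < ?n \<Longrightarrow> \<Phi> p q $$ (j, l) = A $$ (j, l)" for p q A
    using that \<Phi>c[of p q] by (intro eq_matI) auto
  have eq': "(\<Sum>t<?c. (\<Phi> p t * act M (?T i t q)) $$ (j, l))
      = (act N (?T i p 0) * \<Phi> 0 q) $$ (j, l) + (act N (?T i p 1) * \<Phi> 1 q) $$ (j, l)"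
    if i: "i \<in> {1..s}" and "p < ?c" "q < 2" and jl: "j < ?m" "l < ?n" for i p q j l
  proof -
    have "(\<Sum>t<?c. (act N (?T i p t) * \<Phi> t q) $$ (j, l)) = (\<Sum>t<2. (act N (?T i p t) * \<Phi> t q) $$ (j, l))"
      using s(1) jl by (intro sum.mono_neutral_right) (auto simp: quotient_design_zero simps)
    then show ?thesis
      using eq[rule_format, of i p q j l] that s by (auto simp: sum_lessThan_2)
  qed
  have col: "\<Phi> p (2 * i + q) $$ (j, l)
      = (act N (?T i p 0) * \<Phi> 0 q) $$ (j, l) + (act N (?T i p 1) * \<Phi> 1 q) $$ (j, l)"
    if iq: "i \<in> {1..s}" "q < 2" "(i, q) \<noteq> (s, 1)" and p: "p < ?c" and jl: "j < ?m" "l < ?n" for i p q j l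
  proof -
    have "2 * i + q \<noteq> 2 * s + 1 \<and> 2 * i + q \<le> 2 * s + 1" using iq by auto
    then have less: "2 * i + q < ?c" by linarith
    have "(\<Sum>t<?c. (\<Phi> p t * act M (?T i t q)) $$ (j, l))
        = (\<Sum>t<?c. if t = 2 * i + q then \<Phi> p (2 * i + q) $$ (j, l) else 0)"
      using jl by (intro sum.cong refl) (simp add: quotient_design_free[OF s(1) iq] simps)
    also have "\<dots> = \<Phi> p (2 * i + q) $$ (j, l)"
      using less by (simp del: sum.lessThan_Suc)
    finally show ?thesis using eq'[OF iq(1) p iq(2) jl] by (simp only:)
  qed
  have upper: "\<Phi> p t = ?O" if "p < 2" "2 \<le> t" "t < ?c" for p t
  proof -
    obtain i q where iq: "i \<in> {1..s}" "q < 2" "(i, q) \<noteq> (s, 1)" "t = 2 * i + q"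
      using quotient_design_index_cases[OF \<open>2 \<le> t\<close> \<open>t < ?c\<close>] by metis
    show ?thesis
      using col[OF iq(1-3)] that(1) s(1) unfolding iq(4)
      by (intro \<Phi>_eqI) (simp_all add: quotient_design_zero simps)
  qed
  have col_small: "\<Phi> p (2 * i + q) $$ (j, l)
      = (if p = 2 * i then \<Phi> 0 q $$ (j, l) else if p = 2 * i + 1 then \<Phi> 1 q $$ (j, l) else 0)"
    if iq: "i \<in> {1..s}" "q < 2" "i < s" and p: "p < ?c" and jl: "j < ?m" "l < ?n" for i p q j l
  proof -
    have "?T i p 0 = (if p = 2 * i then 1 else 0)" "?T i p 1 = (if p = 2 * i + 1 then 1 else 0)"
      using quotient_design_free[OF s(1) iq(1), of 0 p] quotient_design_free[OF s(1) iq(1), of 1 p] iq(3)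
      by simp_all
    then show ?thesis using col[OF iq(1,2) _ p jl] iq(3) jl by (simp add: simps)
  qed
  \<comment> \<open>Generator s sends copy 1 to the copies 2, 4 and 5, as prescribed by the
    relation.\<close>
  have last: "\<Phi> p 2 $$ (j, l) + (\<Phi> p 4 * act M (letter True)) $$ (j, l) + (\<Phi> p 5 * act M (letter False)) $$ (j, l)
      = (act N (?T s p 0) * \<Phi> 0 1) $$ (j, l) + (act N (?T s p 1) * \<Phi> 1 1) $$ (j, l)"
    if p: "p < ?c" and jl: "j < ?m" "l < ?n" for p j l
  proof -
    have "(\<Sum>t<?c. (\<Phi> p t * act M (?T s t 1)) $$ (j, l)) = (\<Sum>t\<in>{2, 4, 5}. (\<Phi> p t * act M (?T s t 1)) $$ (j, l))"
      using s(1) jl by (intro sum.mono_neutral_right) (auto simp: quotient_design_last[OF s(1), unfolded One_nat_def] simps)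
    also have "\<dots> = \<Phi> p 2 $$ (j, l) + (\<Phi> p 4 * act M (letter True)) $$ (j, l) + (\<Phi> p 5 * act M (letter False)) $$ (j, l)"
      using jl by (simp add: quotient_design_last[OF s(1), unfolded One_nat_def] simps del: index_mult_mat)
    finally show ?thesis using eq'[OF _ p _ jl, of s 1] s(1) by simp
  qed
  have cols: "\<Phi> p 2 $$ (j, l) = (if p = 2 then \<Phi> 0 0 $$ (j, l) else if p = 3 then \<Phi> 1 0 $$ (j, l) else 0)"
    "\<Phi> p 4 $$ (j, l) = (if p = 4 then \<Phi> 0 0 $$ (j, l) else if p = 5 then \<Phi> 1 0 $$ (j, l) else 0)"
    "\<Phi> p 5 $$ (j, l) = (if p = 4 then \<Phi> 0 1 $$ (j, l) else if p = 5 then \<Phi> 1 1 $$ (j, l) else 0)"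
    if p: "p < ?c" and jl: "j < ?m" "l < ?n" for p j l
    using col_small[OF _ _ _ p jl, of 1 0] col_small[OF _ _ _ p jl, of 2 0] col_small[OF _ _ _ p jl, of 2 1] s(1)
    by simp_all
  have cols_mat: "\<Phi> p 4 = (if p = 4 then \<Phi> 0 0 else if p = 5 then \<Phi> 1 0 else ?O)"
    "\<Phi> p 5 = (if p = 4 then \<Phi> 0 1 else if p = 5 then \<Phi> 1 1 else ?O)" if p: "p < ?c" for p
    by (rule \<Phi>_eqI; auto simp: cols[OF p] \<Phi>c)+
  have T_last: "?T s p 0 = (if p = 2 * s then 1 else 0)" for p
    using quotient_design_free[OF s(1), of s 0 p] s(1) by simp
  \<comment> \<open>Row \<open>2 * s\<close> lies outside the rows 2, 3, 4, 5 because
    \<open>3 \<le> s\<close>; the left side of \<open>last\<close> vanishes there, and the right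
    side is the block (0, 1) of A.\<close>
  have z01: "\<Phi> 0 1 = ?O"
  proof (rule \<Phi>_eqI)
    fix j l assume jl: "j < ?m" "l < ?n"
    have "2 * s \<noteq> 2" "2 * s \<noteq> 3" "2 * s \<noteq> 4" "2 * s \<noteq> 5" using s(1) by auto
    then show "\<Phi> 0 1 $$ (j, l) = ?O $$ (j, l)"
      using last[of "2 * s" j l] jl
      by (simp add: cols cols_mat T_last quotient_design_last[OF s(1), unfolded One_nat_def] simps)
  qed simp
  \<comment> \<open>Row 2 compares the two diagonal blocks; row 3 will then give the block (1, 0),
    and rows 4 and 5 the commutation with the letters.\<close>
  have d: "\<Phi> 1 1 = \<Phi> 0 0"
  proof (rule \<Phi>_eqI[OF \<Phi>c])
    fix j l assume jl: "j < ?m" "l < ?n"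
    then show "\<Phi> 1 1 $$ (j, l) = \<Phi> 0 0 $$ (j, l)"
      using last[of 2 j l] s(1)
      by (simp add: cols cols_mat T_last quotient_design_last[OF s(1), unfolded One_nat_def] simps)
  qed
  have z10: "\<Phi> 1 0 = ?O"
  proof (rule \<Phi>_eqI)
    fix j l assume jl: "j < ?m" "l < ?n"
    have "3 \<noteq> 2 * s" by presburger
    then show "\<Phi> 1 0 $$ (j, l) = ?O $$ (j, l)"
      using last[of 3 j l] jl s(1)
      by (simp add: cols cols_mat T_last quotient_design_last[OF s(1), unfolded One_nat_def] simps)
  qed simp
  note facts = cols cols_mat T_last quotient_design_last[OF s(1), unfolded One_nat_def] simps
    z01[unfolded One_nat_def] z10[unfolded One_nat_def] d[unfolded One_nat_def]
  have dims: "dim_row (\<Phi> p q) = ?m" "dim_col (\<Phi> p q) = ?n" "dim_row (act M a) = ?n" "dim_col (act M a) = ?n"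
    "dim_row (act N a) = ?m" "dim_col (act N a) = ?m" for p q a
    using carrier_matD[OF \<Phi>c] carrier_matD[OF act_carrier[OF M]] carrier_matD[OF act_carrier[OF N]] by auto
  have comm_True: "\<Phi> 0 0 * act M (letter True) = act N (letter True) * \<Phi> 0 0"
  proof (rule eq_matI)
    fix j l assume "j < dim_row (act N (letter True) * \<Phi> 0 0)" "l < dim_col (act N (letter True) * \<Phi> 0 0)"
    then have jl: "j < ?m" "l < ?n" by (simp_all add: dims)
    then show "(\<Phi> 0 0 * act M (letter True)) $$ (j, l) = (act N (letter True) * \<Phi> 0 0) $$ (j, l)"
      using last[of 4 j l] s(1) by (simp add: facts del: index_mult_mat)
  qed (simp_all add: dims)
  have comm_False: "\<Phi> 0 0 * act M (letter False) = act N (letter False) * \<Phi> 0 0"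
  proof (rule eq_matI)
    fix j l assume "j < dim_row (act N (letter False) * \<Phi> 0 0)" "l < dim_col (act N (letter False) * \<Phi> 0 0)"
    then have jl: "j < ?m" "l < ?n" by (simp_all add: dims)
    have "5 \<noteq> 2 * s" by presburger
    then show "(\<Phi> 0 0 * act M (letter False)) $$ (j, l) = (act N (letter False) * \<Phi> 0 0) $$ (j, l)"
      using last[of 5 j l] jl s(1) by (simp add: facts del: index_mult_mat)
  qed (simp_all add: dims)
  have "\<Phi> 0 0 * act M (letter x) = act N (letter x) * \<Phi> 0 0" for x
    using comm_True comm_False by (cases x) auto
  then show "\<Phi> 0 0 \<in> fdhom M N"
    by (intro free_algebra_fdhomI[OF M N \<Phi>c])
  show "\<Phi> p q = (if p = q then \<Phi> 0 0 else ?O)" if pq: "p < ?c" "q < ?c" "\<not> (2 \<le> p \<and> q < 2)" for p q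
  proof -
    consider "p < 2" "q < 2" | "p < 2" "2 \<le> q" | "2 \<le> p" "2 \<le> q" using pq(3) by linarith
    then show ?thesis
    proof cases
      case 1
      then have "p = 0 \<or> p = 1" "q = 0 \<or> q = 1" by auto
      then show ?thesis using z01 z10 d by auto
    next
      case 2
      then show ?thesis using upper[OF 2 pq(2)] by auto
    next
      case 3
      obtain i q' where iq: "i \<in> {1..s}" "q' < 2" "(i, q') \<noteq> (s, 1)" "q = 2 * i + q'"
        using quotient_design_index_cases[OF 3(2) pq(2)] by metis
      have q': "q' = 0 \<or> q' = 1" using iq(2) by auto
      show ?thesis
      proof (rule \<Phi>_eqI)
        fix j l assume jl: "j < ?m" "l < ?n"
        show "\<Phi> p q $$ (j, l) = (if p = q then \<Phi> 0 0 else ?O) $$ (j, l)"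
        proof (cases "i = s")
          \<comment> \<open>In column \<open>2 * s\<close> the relation enters only multiplied by
            the block (1, 0) of A, which is 0.\<close>
          case True
          then have "q' = 0" using iq(3) q' by auto
          then show ?thesis
            using col[OF iq(1-3) pq(1) jl] iq(4) True jl
            by (simp add: T_last simps z10[unfolded One_nat_def] del: index_mult_mat)
        next
          case False
          then have "i < s" using iq(1) by auto
          then show ?thesis
            using col_small[OF iq(1,2) _ pq(1) jl] iq(4) q' jl z01 z10 d by auto
        qed
      qed (auto simp: \<Phi>c)
    qed
  qed
qed

lemma kronecker_quotient_design:
  assumes "group_coordinates g r \<chi>" and s: "3 \<le> s" "s \<le> r"
  shows "kronecker_design g r \<chi> (2 * s + 1) 2 s (quotient_design s)"
proof (rule kronecker_design.intro[OF assms(1)], rule kronecker_design_axioms.intro, goal_cases)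
  case (5 p q i)
  then show ?case using quotient_design_zero[OF s(1)] by blast
next
  case 6
  show ?case by (rule injective_quotient_design[OF s(1)])
next
  case (7 i p)
  then show ?case by (auto simp: quotient_design_def)
next
  case 8
  show ?case
    unfolding full_design_def
  proof (intro ballI allI impI, goal_cases)
    case (1 M N \<Phi>)
    note hom = quotient_design_hom[OF 1(1,2) s 1(3,4)]
    show ?case by (rule bexI[OF _ hom(1)]) (intro allI impI hom(2))
  qed
qed (use s in simp_all)

text \<open>The polynomial x^2 - x - 1 takes the value -1 at both 0 and 1, so a root differs from
  both.\<close>

lemma alg_closed_obtain_nonzero_nonone:
  obtains \<mu> :: "'k::alg_closed_field" where "\<mu> \<noteq> 0" "\<mu> \<noteq> 1"
proof -
  have "degree [:-1, -1, 1 :: 'k:] > 0" by simp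
  then obtain \<mu> :: 'k where "poly [:-1, -1, 1:] \<mu> = 0" using alg_closed_imp_poly_has_root by blast
  then show thesis using that[of \<mu>] by (cases "\<mu> = 0 \<or> \<mu> = 1") auto
qed

theorem corollary4p2p2:
  fixes g :: "nat \<Rightarrow> 'e::ab_group_add" and r d :: nat
  assumes "CHAR('k::alg_closed_field) > 0"
    and "elementary_abelian CHAR('k) r g"
    and "r \<ge> 3" and "1 \<le> d" and "d \<le> r - 1"
  shows "wild (ESP2 g r d - ESP2 g r (d - 1) :: ('e, 'k) fdmod set)"
proof -
  obtain \<chi> :: "nat \<Rightarrow> 'e \<Rightarrow> 'k" where
    \<chi>: "\<And>i x y. i \<in> {1..r} \<Longrightarrow> \<chi> i (x + y) = \<chi> i x + \<chi> i y"
    "\<And>i j. i \<in> {1..r} \<Longrightarrow> j \<in> {1..r} \<Longrightarrow> \<chi> i (g j) = (if i = j then 1 else 0)"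
    using elementary_abelian_coordinates[OF assms(1,2)] by blast
  have gc: "group_coordinates g r \<chi>" using \<chi> by (rule group_coordinates.intro)
  \<comment> \<open>From \<open>d \<le> r - 1\<close> one gets \<open>2 \<le> s\<close>, and from
    \<open>1 \<le> d\<close> one gets \<open>s \<le> r\<close>.\<close>
  obtain s where s: "d + s = r + 1" using assms(4,5) by (intro that[of "r + 1 - d"]) auto
  show ?thesis
  proof (cases "s = 2")
    case True
    obtain \<mu> :: 'k where "\<mu> \<noteq> 0" "\<mu> \<noteq> 1" by (rule alg_closed_obtain_nonzero_nonone)
    then show ?thesis
      using wild_if_kronecker_design[OF kronecker_eigen_design[OF gc assms(3)]] s True by blast
  next
    case False
    then have "3 \<le> s" "s \<le> r" using s assms(3-5) by auto
    then show ?thesis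
      using wild_if_kronecker_design[OF kronecker_quotient_design[OF gc] s] by blast
  qed
qed

end
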